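(* Let $\mu$ be a probability measure with finite moments of all orders such that $p_d(\mu)$ is real-rooted for every $d\ge1$. Then the sequence $(p_d(\mu))_{d\ge1}$ has an infinitesimal asymptotic distribution $(\mu,\mu')$: for all $n\ge1$, $m_n:=\lim_{d\to\infty}m_n(p_d(\mu))=m_n(\mu)$ and $m_n':=\lim_{d\to\infty}d\,(m_n(p_d(\mu))-m_n)$ exist. Moreover, as formal series, \[G_{inf}(z)=\frac{G_\mu''(z)}{2G_\mu'(z)}-\frac{G_\mu'(z)}{G_\mu(z)},\qquad R_{inf}(z)=\frac{K''_\mu(z)}{2K'_\mu(z)}+\frac1z.\]
   Context: For a monic polynomial $p$ of degree $d$ with roots $\lambda_i$ write $p(x)=\sum_{i=0}^d(-1)^ia^p_ix^{d-i}$ and $m_n(p)=\frac1d\sum_i\lambda_i^n$; its finite free cumulants are $\kappa_n^d(p)=\frac{(-d)^n}{d(n-1)!}\sum_{\pi\in P(n)}(-1)^{|\pi|}\frac{N!_\pi a_\pi^p(|\pi|-1)!}{(d)_\pi}$ for $1\le n\le d$ ($P(n)$ the set partitions of $\{1,\dots,n\}$, $|\pi|$ the number of blocks, $a^p_\pi=\prod_{V\in\pi}a^p_{|V|}$, $N!_\pi=\prod_V|V|!$, $(d)_\pi=\prod_V(d)_{|V|}$, $(d)_k=d(d-1)\cdots(d-k+1)$). The free cumulants $\kappa_n(\mu)$ are defined by $m_n(\mu)=\sum_{\pi\in NC(n)}\prod_{V\in\pi}\kappa_{|V|}(\mu)$. $p_d(\mu)$ is the unique monic polynomial of degree $d$ with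 $\kappa_n^d(p_d(\mu))=\kappa_n(\mu)$ for $1\le n\le d$. $G_\mu(z)=\sum_{n\ge0}m_n(\mu)z^{-n-1}$; $K_\mu(z)=\frac1z+\sum_{n\ge1}\kappa_n(\mu)z^{n-1}$ is its compositional inverse ($G_\mu(K_\mu(z))=z$). $G_{inf}(z)=\sum_{n\ge1}m_n'z^{-n-1}$ is the infinitesimal Cauchy transform and the infinitesimal $R$-transform is $R_{inf}(z)=-K'_\mu(z)\,G_{inf}(K_\mu(z))$. *)

theory Defs
  imports
    "HOL-Probability.Probability"
    "HOL-Computational_Algebra.Computational_Algebra"
begin

definition set_partitions :: "nat \<Rightarrow> nat set set set" where
  "set_partitions n = {\<pi>. partition_on {1..n} \<pi>}"

definition noncrossing :: "nat set set \<Rightarrow> bool" where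
  "noncrossing \<pi> \<longleftrightarrow>
     \<not> (\<exists>V\<in>\<pi>. \<exists>W\<in>\<pi>. V \<noteq> W \<and>
          (\<exists>a\<in>V. \<exists>b\<in>W. \<exists>c\<in>V. \<exists>d\<in>W. a < b \<and> b < c \<and> c < d))"

definition nc_partitions :: "nat \<Rightarrow> nat set set set" where
  "nc_partitions n = {\<pi>\<in>set_partitions n. noncrossing \<pi>}"

definition falling_factorial :: "real \<Rightarrow> nat \<Rightarrow> real" where
  "falling_factorial x k = (\<Prod>i<k. x - real i)"


subsection \<open>Moments and free cumulants of a measure\<close>

definition moment :: "real measure \<Rightarrow> nat \<Rightarrow> real" where
  "moment \<mu> n = (LINT x|\<mu>. x ^ n)"

text \<open>Cumulants start at index 1; the value at index 0 is set to 0 to make the sequence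
  unique. See \<open>free_cumulants_of_unique\<close> below.\<close>

definition is_free_cumulants_of :: "(nat \<Rightarrow> real) \<Rightarrow> (nat \<Rightarrow> real) \<Rightarrow> bool" where
  "is_free_cumulants_of m \<kappa> \<longleftrightarrow>
     \<kappa> 0 = 0 \<and> (\<forall>n\<ge>1. m n = (\<Sum>\<pi>\<in>nc_partitions n. \<Prod>V\<in>\<pi>. \<kappa> (card V)))"

definition free_cumulant :: "real measure \<Rightarrow> nat \<Rightarrow> real" where
  "free_cumulant \<mu> = (THE \<kappa>. is_free_cumulants_of (moment \<mu>) \<kappa>)"


subsection \<open>Finite free cumulants of a polynomial\<close>

definition signed_coeff :: "real poly \<Rightarrow> nat \<Rightarrow> real" where
  "signed_coeff p i = (-1) ^ i * coeff p (degree p - i)"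

text \<open>Meaningful for \<open>1 \<le> n \<le> degree p\<close>.\<close>

definition finite_free_cumulant :: "real poly \<Rightarrow> nat \<Rightarrow> real" where
  "finite_free_cumulant p n =
     (let d = real (degree p) in
      (- d) ^ n / (d * fact (n - 1)) *
      (\<Sum>\<pi>\<in>set_partitions n.
         (-1) ^ card \<pi> *
         ((\<Prod>V\<in>\<pi>. fact (card V)) * (\<Prod>V\<in>\<pi>. signed_coeff p (card V)) * fact (card \<pi> - 1)) /
         (\<Prod>V\<in>\<pi>. falling_factorial d (card V))))"

definition has_finite_free_cumulants :: "nat \<Rightarrow> (nat \<Rightarrow> real) \<Rightarrow> real poly \<Rightarrow> bool" where
  "has_finite_free_cumulants d \<kappa> p \<longleftrightarrow>
     lead_coeff p = 1 \<and> degree p = d \<and> (\<forall>n\<in>{1..d}. finite_free_cumulant p n = \<kappa> n)"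

text \<open>The polynomial $p_d(\mu)$; see \<open>has_finite_free_cumulants_unique\<close> below.\<close>

definition measure_poly :: "real measure \<Rightarrow> nat \<Rightarrow> real poly" where
  "measure_poly \<mu> d = (THE p. has_finite_free_cumulants d (free_cumulant \<mu>) p)"

definition real_rooted :: "real poly \<Rightarrow> bool" where
  "real_rooted p \<longleftrightarrow> (\<forall>z::complex. poly (map_poly of_real p) z = 0 \<longrightarrow> z \<in> \<real>)"

text \<open>Only real roots are counted (with multiplicity), so this is the average over all roots
  precisely when \<open>p\<close> is real-rooted.\<close>

definition poly_moment :: "real poly \<Rightarrow> nat \<Rightarrow> real" where
  "poly_moment p n = (\<Sum>x\<in>#proots p. x ^ n) / real (degree p)"

text \<open>The pair $(\mu,\mu')$ enters through its moment sequences \<open>m\<close> and \<open>m'\<close>; $\mu'$ is in general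
  only a linear functional on polynomials. Limits are unique, so \<open>m' n\<close> is the limit
  $m_n'$ for every \<open>n \<ge> 1\<close>; \<open>m' 0\<close> plays no role.\<close>

definition infinitesimal_asymptotic_distribution ::
    "(nat \<Rightarrow> real poly) \<Rightarrow> (nat \<Rightarrow> real) \<Rightarrow> (nat \<Rightarrow> real) \<Rightarrow> bool" where
  "infinitesimal_asymptotic_distribution p m m' \<longleftrightarrow>
     (\<forall>n\<ge>1. (\<lambda>d. poly_moment (p d) n) \<longlonglongrightarrow> m n \<and>
            (\<lambda>d. real d * (poly_moment (p d) n - m n)) \<longlonglongrightarrow> m' n)"


subsection \<open>Formal transforms\<close>

text \<open>A formal Laurent series in $1/z$, such as $G_\mu(z)$, is represented by the
  \<open>real fls\<close> in the variable $w = 1/z$: the coefficient of $z^{-k}$ is the \<open>k\<close>-th one.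
  Since $dw/dz = -w^2$, differentiation with respect to $z$ is $-w^2\,d/dw$, and substituting
  $z = K(u)$, for a Laurent series \<open>K\<close> in \<open>u\<close> with a pole at 0, is substituting the power
  series $1/K(u)$ for \<open>w\<close>.\<close>

definition deriv_at_inf :: "real fls \<Rightarrow> real fls" where
  "deriv_at_inf F = - (fls_X ^ 2) * fls_deriv F"

definition compose_at_inf :: "real fls \<Rightarrow> real fls \<Rightarrow> real fls" where
  "compose_at_inf F K = fls_compose_fps F (fls_regpart (inverse K))"

definition cauchy_transform :: "real measure \<Rightarrow> real fls" where
  "cauchy_transform \<mu> = fps_to_fls (Abs_fps (\<lambda>k. if k = 0 then 0 else moment \<mu> (k - 1)))"

definition inf_cauchy_transform :: "(nat \<Rightarrow> real) \<Rightarrow> real fls" where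
  "inf_cauchy_transform m' = fps_to_fls (Abs_fps (\<lambda>k. if k \<le> 1 then 0 else m' (k - 1)))"

text \<open>The following two are Laurent series in the variable $z$ itself.\<close>

definition K_transform :: "real measure \<Rightarrow> real fls" where
  "K_transform \<mu> = fls_X_inv + fps_to_fls (Abs_fps (\<lambda>k. free_cumulant \<mu> (k + 1)))"

definition inf_R_transform :: "real measure \<Rightarrow> (nat \<Rightarrow> real) \<Rightarrow> real fls" where
  "inf_R_transform \<mu> m' =
     - fls_deriv (K_transform \<mu>) * compose_at_inf (inf_cauchy_transform m') (K_transform \<mu>)"


subsection \<open>The definite descriptions are well-defined\<close>

lemma strong_recursion_unique:
  fixes F :: "nat \<Rightarrow> (nat \<Rightarrow> real) \<Rightarrow> real"
  assumes F: "\<And>n f g. (\<And>k. k < n \<Longrightarrow> f k = g k) \<Longrightarrow> F n f = F n g"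
  shows "\<exists>!f. \<forall>n. f n = F n f"
proof (rule ex_ex1I)
  define f where "f = wfrec less_than (\<lambda>f n. F n f)"
  have "f n = F n f" for n
  proof -
    have "f n = F n (cut f less_than n)"
      unfolding f_def by (subst wfrec) auto
    also have "\<dots> = F n f"
      by (rule F) (simp add: cut_def)
    finally show ?thesis .
  qed
  thus "\<exists>f. \<forall>n. f n = F n f" by blast
next
  fix f g assume *: "\<forall>n. f n = F n f" "\<forall>n. g n = F n g"
  have "f n = g n" for n
  proof (induction n rule: less_induct)
    case (less n)
    hence "F n f = F n g" by (intro F)
    thus ?case using * by metis
  qed
  thus "f = g" by blast
qed

lemma finite_set_partitions: "finite (set_partitions n)"
  unfolding set_partitions_def by (rule finitely_many_partition_on) simp

lemma finite_nc_partitions: "finite (nc_partitions n)"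
  unfolding nc_partitions_def using finite_set_partitions by simp

lemma one_block_partition: "n \<ge> 1 \<Longrightarrow> {{1..n}} \<in> set_partitions n"
  unfolding set_partitions_def by (auto intro: partition_on_space)

lemma one_block_nc_partition: "n \<ge> 1 \<Longrightarrow> {{1..n}} \<in> nc_partitions n"
proof -
  assume "n \<ge> 1"
  moreover have "noncrossing {{1..n}}"
    unfolding noncrossing_def by blast
  ultimately show ?thesis
    unfolding nc_partitions_def using one_block_partition by blast
qed

lemma card_block_less:
  assumes "\<pi> \<in> set_partitions n" "\<pi> \<noteq> {{1..n}}" "V \<in> \<pi>"
  shows "card V < n"
proof -
  have p: "partition_on {1..n} \<pi>" using assms by (simp add: set_partitions_def)
  have sub: "V \<subseteq> {1..n}" using partition_onD1[OF p] assms(3) by auto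
  have "V \<noteq> {1..n}"
  proof
    assume V: "V = {1..n}"
    have "W = V" if "W \<in> \<pi>" for W
    proof (rule ccontr)
      assume "W \<noteq> V"
      hence "disjnt W V"
        using partition_onD2[OF p] that assms(3) by (auto simp: pairwise_def)
      moreover have "W \<subseteq> V" using partition_onD1[OF p] that V by auto
      moreover have "W \<noteq> {}" using partition_onD3[OF p] that by auto
      ultimately show False by (auto simp: disjnt_def)
    qed
    hence "\<pi> = {{1..n}}" using assms(3) V by blast
    thus False using assms(2) by simp
  qed
  with sub have "V \<subset> {1..n}" by (rule psubsetI)
  hence "card V < card {1..n}" by (rule psubset_card_mono[OF finite_atLeastAtMost])
  thus ?thesis by simp
qed

lemma free_cumulants_of_unique: "\<exists>!\<kappa>. is_free_cumulants_of m \<kappa>"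
proof -
  define F where "F n \<kappa> = (if n = 0 then 0 else
      m n - (\<Sum>\<pi>\<in>nc_partitions n - {{{1..n}}}. \<Prod>V\<in>\<pi>. \<kappa> (card V)))" for n and \<kappa> :: "nat \<Rightarrow> real"
  have "\<exists>!\<kappa>. \<forall>n. \<kappa> n = F n \<kappa>"
  proof (rule strong_recursion_unique)
    fix n and f g :: "nat \<Rightarrow> real" assume eq: "\<And>k. k < n \<Longrightarrow> f k = g k"
    have "(\<Sum>\<pi>\<in>nc_partitions n - {{{1..n}}}. \<Prod>V\<in>\<pi>. f (card V)) =
          (\<Sum>\<pi>\<in>nc_partitions n - {{{1..n}}}. \<Prod>V\<in>\<pi>. g (card V))"
      by (intro sum.cong prod.cong refl eq)
         (auto simp: nc_partitions_def intro!: card_block_less)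
    thus "F n f = F n g" by (simp add: F_def)
  qed
  moreover have "is_free_cumulants_of m \<kappa> \<longleftrightarrow> (\<forall>n. \<kappa> n = F n \<kappa>)" for \<kappa>
  proof -
    have "(\<Sum>\<pi>\<in>nc_partitions n. \<Prod>V\<in>\<pi>. \<kappa> (card V)) =
            \<kappa> n + (\<Sum>\<pi>\<in>nc_partitions n - {{{1..n}}}. \<Prod>V\<in>\<pi>. \<kappa> (card V))" if "n \<ge> 1" for n
      by (subst sum.remove[OF finite_nc_partitions one_block_nc_partition[OF that]]) simp
    hence "m n = (\<Sum>\<pi>\<in>nc_partitions n. \<Prod>V\<in>\<pi>. \<kappa> (card V)) \<longleftrightarrow> \<kappa> n = F n \<kappa>" if "n \<ge> 1" for n
      using that by (auto simp: F_def)
    moreover have "\<kappa> 0 = 0 \<longleftrightarrow> \<kappa> 0 = F 0 \<kappa>" by (simp add: F_def)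
    ultimately show ?thesis
      unfolding is_free_cumulants_of_def by (metis One_nat_def Suc_leI neq0_conv)
  qed
  ultimately show ?thesis by simp
qed

lemma is_free_cumulants_of_free_cumulant:
  "is_free_cumulants_of (moment \<mu>) (free_cumulant \<mu>)"
  unfolding free_cumulant_def by (rule theI'[OF free_cumulants_of_unique])

lemma falling_factorial_nonzero: "k \<le> d \<Longrightarrow> falling_factorial (real d) k \<noteq> 0"
  by (auto simp: falling_factorial_def)

lemma has_finite_free_cumulants_unique: "\<exists>!p. has_finite_free_cumulants d \<kappa> p"
proof -
  define T where "T a \<pi> = (-1) ^ card \<pi> *
         ((\<Prod>V\<in>\<pi>. fact (card V)) * (\<Prod>V\<in>\<pi>. a (card V)) * fact (card \<pi> - 1)) /
         (\<Prod>V\<in>\<pi>. falling_factorial (real d) (card V))" for a :: "nat \<Rightarrow> real" and \<pi> :: "nat set set"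
  define c where "c n = (- real d) ^ n / (real d * fact (n - 1))" for n
  define b where "b n = - fact n / falling_factorial (real d) n" for n
  define S where "S a n = (\<Sum>\<pi>\<in>set_partitions n - {{{1..n}}}. T a \<pi>)" for a n
  define F where "F n a = (if n = 0 then 1 else if n > d then 0 else (\<kappa> n / c n - S a n) / b n)"
    for n a
  have c: "c n \<noteq> 0" if "n \<in> {1..d}" for n using that by (auto simp: c_def)
  have b: "b n \<noteq> 0" if "n \<in> {1..d}" for n
    using that falling_factorial_nonzero[of n d] by (auto simp: b_def)
  have "\<exists>!a. \<forall>n. a n = F n a"
  proof (rule strong_recursion_unique)
    fix n and f g :: "nat \<Rightarrow> real" assume eq: "\<And>k. k < n \<Longrightarrow> f k = g k"
    have "S f n = S g n"
      unfolding S_def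
    proof (rule sum.cong)
      fix \<pi> assume "\<pi> \<in> set_partitions n - {{{1..n}}}"
      hence "(\<Prod>V\<in>\<pi>. f (card V)) = (\<Prod>V\<in>\<pi>. g (card V))"
        by (intro prod.cong refl eq) (auto intro!: card_block_less)
      thus "T f \<pi> = T g \<pi>" by (simp add: T_def)
    qed simp
    thus "F n f = F n g" by (simp add: F_def)
  qed
  then obtain a where a: "\<And>n. a n = F n a" and a_unique: "\<And>f. (\<And>n. f n = F n f) \<Longrightarrow> f = a"
    by metis
  have cum: "c n * (\<Sum>\<pi>\<in>set_partitions n. T f \<pi>) = \<kappa> n \<longleftrightarrow> f n = F n f"
    if "n \<in> {1..d}" for f n
  proof -
    have "(\<Sum>\<pi>\<in>set_partitions n. T f \<pi>) = T f {{1..n}} + S f n"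
      unfolding S_def using that
      by (intro sum.remove finite_set_partitions one_block_partition) auto
    also have "T f {{1..n}} = b n * f n" by (simp add: T_def b_def)
    finally show ?thesis
      using b[OF that] c[OF that] that by (auto simp: F_def field_simps)
  qed
  have ffc: "finite_free_cumulant p n = c n * (\<Sum>\<pi>\<in>set_partitions n. T f \<pi>)"
    if p: "degree p = d" "n \<le> d" and f: "\<And>i. i \<le> d \<Longrightarrow> f i = signed_coeff p i" for p f n
  proof -
    have "(\<Prod>V\<in>\<pi>. f (card V)) = (\<Prod>V\<in>\<pi>. signed_coeff p (card V))" if "\<pi> \<in> set_partitions n" for \<pi>
    proof (intro prod.cong refl f)
      fix V assume "V \<in> \<pi>"
      hence "V \<subseteq> {1..n}" using that by (auto simp: set_partitions_def partition_on_def)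
      hence "card V \<le> card {1..n}" by (intro card_mono) auto
      thus "card V \<le> d" using p by simp
    qed
    thus ?thesis
      unfolding finite_free_cumulant_def c_def T_def by (simp add: p Let_def)
  qed
  define q where "q = (\<Sum>i\<le>d. monom ((-1) ^ i * a i) (d - i))"
  have coeff_q: "coeff q (d - i) = (-1) ^ i * a i" if "i \<le> d" for i
  proof -
    have "coeff q (d - i) = (\<Sum>j\<le>d. if j = i then (-1) ^ i * a i else 0)"
      unfolding q_def coeff_sum using that by (intro sum.cong) auto
    also have "\<dots> = (-1) ^ i * a i" using that by simp
    finally show ?thesis .
  qed
  have a0: "a 0 = 1" using a[of 0] by (simp add: F_def)
  have deg_q: "degree q = d"
  proof (rule antisym)
    show "degree q \<le> d" unfolding q_def
      by (intro degree_sum_le) (auto intro: order_trans[OF degree_monom_le])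
    show "d \<le> degree q" using coeff_q[of 0] a0 by (intro le_degree) simp
  qed
  show ?thesis
  proof (rule ex1I[of _ q])
    have sq: "a i = signed_coeff q i" if "i \<le> d" for i
      using coeff_q[OF that] by (simp add: signed_coeff_def deg_q flip: mult.assoc power_mult_distrib)
    show "has_finite_free_cumulants d \<kappa> q"
      unfolding has_finite_free_cumulants_def
    proof (intro conjI ballI)
      show "lead_coeff q = 1" using coeff_q[of 0] a0 by (simp add: deg_q)
      show "degree q = d" by (rule deg_q)
      fix n assume n: "n \<in> {1..d}"
      have "finite_free_cumulant q n = c n * (\<Sum>\<pi>\<in>set_partitions n. T a \<pi>)"
        using n by (intro ffc deg_q sq) auto
      thus "finite_free_cumulant q n = \<kappa> n" using cum[OF n] a by metis
    qed
  next
    fix p assume "has_finite_free_cumulants d \<kappa> p"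
    hence lead: "lead_coeff p = 1" and deg: "degree p = d"
      and kap: "\<And>n. n \<in> {1..d} \<Longrightarrow> finite_free_cumulant p n = \<kappa> n"
      by (auto simp: has_finite_free_cumulants_def)
    define f where "f i = (if i \<le> d then signed_coeff p i else 0)" for i
    have "f = a"
    proof (rule a_unique)
      fix n
      consider "n = 0" | "n \<in> {1..d}" | "n > d" by fastforce
      thus "f n = F n f"
      proof cases
        case 1
        thus ?thesis using lead by (simp add: f_def F_def signed_coeff_def)
      next
        case 2
        have "finite_free_cumulant p n = c n * (\<Sum>\<pi>\<in>set_partitions n. T f \<pi>)"
          using 2 by (intro ffc deg) (auto simp: f_def)
        thus ?thesis using cum[OF 2] kap[OF 2] by metis
      next
        case 3
        thus ?thesis by (simp add: f_def F_def)
      qed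
    qed
    show "p = q"
    proof (rule poly_eqI)
      fix k
      show "coeff p k = coeff q k"
      proof (cases "k \<le> d")
        case True
        have "a (d - k) = signed_coeff p (d - k)"
          unfolding \<open>f = a\<close>[symmetric] by (simp add: f_def)
        hence "coeff p k = (-1) ^ (d - k) * a (d - k)"
          using True by (simp add: signed_coeff_def deg flip: mult.assoc power_mult_distrib)
        also have "\<dots> = coeff q k" using coeff_q[of "d - k"] True by simp
        finally show ?thesis .
      next
        case False
        thus ?thesis by (simp add: coeff_eq_0 deg deg_q)
      qed
    qed
  qed
qed

lemma has_finite_free_cumulants_measure_poly:
  "has_finite_free_cumulants d (free_cumulant \<mu>) (measure_poly \<mu> d)"
  unfolding measure_poly_def by (rule theI'[OF has_finite_free_cumulants_unique])

end

theory Submission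
  imports Defs
begin

text \<open>
  Write $D = d/dx$. The finite free cumulants are, up to scaling, the coefficients of $\log h$
  for the series $h$ with $p(x) = h(D)\, x^d$, so that
  $p_d(\mu) = \exp(-d \sum_n \kappa_n (D/d)^n / n)\, x^d$. Commuting the exponential with $x D$
  gives the differential equation $x p'/d = \sum_{n \ge 0} \kappa_n p^{(n)} / d^n$ with
  $\kappa_0 := 1$. Dividing by $p$ and putting $g = p'/(d p)$, the Cauchy transform of $p$, one gets
  $x g = \sum_n \kappa_n q_n$ with $q_0 = 1$ and $q_{n+1} = q_n g + q_n'/d$, that is
  $q_n = g^n + {n \choose 2} g^{n-2} g' / d + O(d^{-2})$. This recursion determines the coefficients
  of $g$ one after the other and shows that each has an expansion $G + B/d + o(1/d)$. With
  $F(u) = 1 + \sum_{n \ge 1} \kappa_n u^n = u K(u)$, comparing orders yields $x G = F(G)$, which is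
  the equation for $G_\mu$ given by the recursive structure of noncrossing partitions, and
  $x B = F'(G) B + F''(G) G' / 2$, which is solved for $B = G_{inf}$.
\<close>

text \<open>In the variable w = 1/x the operator d/dx is - w^2 d/dw, which raises the order of a
  series, as multiplication by g does. Hence q_n starts at order n, and coefficient k + 1 of g is a
  sum over n \<le> k, a range that does not grow with d. Every limit is therefore taken inside a
  fixed finite sum, and no estimate uniform in d has to be found. The number n choose 2 arises
  because, to first order, only one of the n steps building q_n differentiates: after i factors g it
  yields i g^(i-1) g', and i runs over i < n. Differentiating x G = F(G) gives x - F'(G) = - G/G',
  so B = - F''(G) G'^2 / (2 G); a second derivative expresses F''(G) by G, G' and G''. For R_inf the
  substitution x = K(u) is made in the equation for B itself, where it turns G into u.\<close>

unbundle no vec_syntax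

section \<open>Sums over set partitions\<close>

lemma partition_on_block_subset: "partition_on A \<pi> \<Longrightarrow> V \<in> \<pi> \<Longrightarrow> V \<subseteq> A"
  unfolding partition_on_def by blast

lemma partition_on_block_unique:
  "partition_on A \<pi> \<Longrightarrow> V \<in> \<pi> \<Longrightarrow> W \<in> \<pi> \<Longrightarrow> a \<in> V \<Longrightarrow> a \<in> W \<Longrightarrow> V = W"
  unfolding partition_on_def disjoint_def by blast

lemma sum_Collect_conj:
  fixes g :: "'a \<Rightarrow> 'b::comm_monoid_add"
  assumes "finite {x. Q x}"
  shows "(\<Sum>x | Q x \<and> P x. g x) = (\<Sum>x | Q x. if P x then g x else 0)"
  using sum.inter_filter[OF assms, of g P] by simp

text \<open>A partition is the block of \<open>a\<close> together with a partition of what that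
  block leaves over. Both block-removal recursions below, for all and for noncrossing partitions,
  start here.\<close>

lemma sum_partition_on_insert:
  fixes h :: "'a set set \<Rightarrow> 'b::comm_monoid_add"
  assumes A: "finite A" and a: "a \<notin> A"
  shows "(\<Sum>\<pi> | partition_on (insert a A) \<pi>. h \<pi>) =
         (\<Sum>B\<in>Pow A. \<Sum>\<pi> | partition_on (A - B) \<pi>. h (insert (insert a B) \<pi>))"
proof -
  define blk where "blk \<pi> = (THE V. V \<in> \<pi> \<and> a \<in> V)" for \<pi>
  have blk: "blk \<pi> = V" if "partition_on (insert a A) \<pi>" "V \<in> \<pi>" "a \<in> V" for \<pi> V
    unfolding blk_def using that by (intro the_equality conjI) (blast dest: partition_on_block_unique)+
  have dj: "disjnt (insert a B) (\<Union>\<pi>)" if "partition_on (A - B) \<pi>" for B \<pi>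
    using partition_onD1[OF that] a unfolding disjnt_def by blast
  have part: "partition_on (insert a A) (insert (insert a B) \<pi>)"
    if "B \<subseteq> A" "partition_on (A - B) \<pi>" for B \<pi>
  proof -
    have "insert a A - insert a B = A - B" using a by blast
    thus ?thesis using partition_on_insert[OF dj[OF that(2)], of "insert a A"] that by auto
  qed
  have nin: "insert a B \<notin> \<pi>" if "partition_on (A - B) \<pi>" for B \<pi>
    using partition_onD1[OF that] a by blast
  have "(\<Sum>B\<in>Pow A. \<Sum>\<pi> | partition_on (A - B) \<pi>. h (insert (insert a B) \<pi>)) =
        (\<Sum>(B, \<pi>) \<in> (SIGMA B:Pow A. {\<pi>. partition_on (A - B) \<pi>}). h (insert (insert a B) \<pi>))"
    using A by (intro sum.Sigma) (auto intro: finitely_many_partition_on)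
  also have "\<dots> = (\<Sum>\<pi> | partition_on (insert a A) \<pi>. h \<pi>)"
  proof (rule sum.reindex_bij_witness[where j = "\<lambda>(B, \<pi>). insert (insert a B) \<pi>"
        and i = "\<lambda>\<pi>. (blk \<pi> - {a}, \<pi> - {blk \<pi>})"], goal_cases)
    case (1 c)
    then obtain B \<pi> where c: "c = (B, \<pi>)" and B: "B \<subseteq> A" and p: "partition_on (A - B) \<pi>" by auto
    have "blk (insert (insert a B) \<pi>) = insert a B"
      by (rule blk[OF part[OF B p]]) auto
    moreover have "insert a B - {a} = B" using a B by blast
    ultimately show ?case using nin[OF p] by (simp add: c)
  next
    case (2 c)
    thus ?case using part by auto
  next
    case (3 \<pi>)
    hence p: "partition_on (insert a A) \<pi>" by simp
    obtain V where V: "V \<in> \<pi>" "a \<in> V"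
      using partition_onD1[OF p] by blast
    have "insert a (V - {a}) = V" "insert V (\<pi> - {V}) = \<pi>" using V by auto
    thus ?case using blk[OF p V] by simp
  next
    case (4 \<pi>)
    hence p: "partition_on (insert a A) \<pi>" by simp
    obtain V where V: "V \<in> \<pi>" "a \<in> V"
      using partition_onD1[OF p] by blast
    have "disjnt V (\<Union>(\<pi> - {V}))"
      using partition_on_block_unique[OF p V(1)] by (auto simp: disjnt_def)
    hence "partition_on (insert a A - V) (\<pi> - {V})"
      using partition_on_insert[of V "\<pi> - {V}" "insert a A"] p V by (simp add: insert_absorb)
    moreover have "insert a A - V = A - (V - {a})" using V a by blast
    moreover have "V - {a} \<subseteq> A" using partition_on_block_subset[OF p V(1)] by blast
    ultimately show ?case
      using blk[OF p V] by simp
  next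
    case (5 c)
    thus ?case by auto
  qed
  finally show ?thesis by simp
qed

text \<open>Restricting to either side inverts the union: blocks are nonempty and \<open>X\<close>,
  \<open>Y\<close> disjoint, so each block lies in exactly one of the two sets.\<close>

lemma sum_partition_on_Un:
  fixes h :: "'a set set \<Rightarrow> 'b::comm_monoid_add"
  assumes fin: "finite X" "finite Y" and disj: "X \<inter> Y = {}"
  shows "(\<Sum>\<pi> | partition_on (X \<union> Y) \<pi> \<and> (\<forall>V\<in>\<pi>. V \<subseteq> X \<or> V \<subseteq> Y). h \<pi>) =
         (\<Sum>\<rho> | partition_on X \<rho>. \<Sum>\<sigma> | partition_on Y \<sigma>. h (\<rho> \<union> \<sigma>))"
proof -
  have "(\<Sum>\<rho> | partition_on X \<rho>. \<Sum>\<sigma> | partition_on Y \<sigma>. h (\<rho> \<union> \<sigma>)) =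
        (\<Sum>(\<rho>, \<sigma>) \<in> {\<rho>. partition_on X \<rho>} \<times> {\<sigma>. partition_on Y \<sigma>}. h (\<rho> \<union> \<sigma>))"
    by (rule sum.cartesian_product)
  also have "\<dots> = (\<Sum>\<pi> | partition_on (X \<union> Y) \<pi> \<and> (\<forall>V\<in>\<pi>. V \<subseteq> X \<or> V \<subseteq> Y). h \<pi>)"
  proof (rule sum.reindex_bij_witness[where j = "\<lambda>(\<rho>, \<sigma>). \<rho> \<union> \<sigma>"
        and i = "\<lambda>\<pi>. ({V\<in>\<pi>. V \<subseteq> X}, {V\<in>\<pi>. V \<subseteq> Y})"], goal_cases)
    case (1 c)
    then obtain \<rho> \<sigma> where c: "c = (\<rho>, \<sigma>)" and p: "partition_on X \<rho>" "partition_on Y \<sigma>" by auto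
    have nonempty: "V \<noteq> {}" if "V \<in> \<rho> \<union> \<sigma>" for V
      using that partition_onD3[OF p(1)] partition_onD3[OF p(2)] by auto
    have "V \<subseteq> X \<and> \<not> V \<subseteq> Y" if "V \<in> \<rho>" for V
      using partition_on_block_subset[OF p(1) that] nonempty[of V] that disj by auto
    moreover have "V \<subseteq> Y \<and> \<not> V \<subseteq> X" if "V \<in> \<sigma>" for V
      using partition_on_block_subset[OF p(2) that] nonempty[of V] that disj by auto
    ultimately show ?case unfolding c by auto
  next
    case (2 c)
    then obtain \<rho> \<sigma> where c: "c = (\<rho>, \<sigma>)" and p: "partition_on X \<rho>" "partition_on Y \<sigma>" by auto
    have sub: "\<And>V. V \<in> \<rho> \<Longrightarrow> V \<subseteq> X" "\<And>V. V \<in> \<sigma> \<Longrightarrow> V \<subseteq> Y"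
      using p partition_on_block_subset by blast+
    have "partition_on (X \<union> Y) (\<rho> \<union> \<sigma>)"
    proof (rule partition_onI)
      show "\<Union>(\<rho> \<union> \<sigma>) = X \<union> Y"
        using partition_onD1[OF p(1)] partition_onD1[OF p(2)] by simp
      show "disjnt V W" if VW: "V \<in> \<rho> \<union> \<sigma>" "W \<in> \<rho> \<union> \<sigma>" "V \<noteq> W" for V W
      proof (rule ccontr)
        assume "\<not> disjnt V W"
        then obtain x where x: "x \<in> V" "x \<in> W" by (auto simp: disjnt_def)
        show False
          using VW x sub disj partition_on_block_unique[OF p(1)] partition_on_block_unique[OF p(2)]
          by blast
      qed
      show "{} \<notin> \<rho> \<union> \<sigma>"
        using partition_onD3[OF p(1)] partition_onD3[OF p(2)] by auto
    qed
    thus ?case unfolding c using sub by auto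
  next
    case (3 \<pi>)
    thus ?case by auto
  next
    case (4 \<pi>)
    hence p: "partition_on (X \<union> Y) \<pi>" and V: "\<forall>V\<in>\<pi>. V \<subseteq> X \<or> V \<subseteq> Y" by auto
    have U: "\<Union>\<pi> = X \<union> Y" using partition_onD1[OF p] by simp
    have "partition_on Z {V\<in>\<pi>. V \<subseteq> Z}" if Z: "Z = X \<or> Z = Y" for Z
    proof (rule partition_onI)
      show "\<Union>{V\<in>\<pi>. V \<subseteq> Z} = Z"
      proof (intro equalityI subsetI)
        fix x assume x: "x \<in> Z"
        then obtain V' where V': "V' \<in> \<pi>" "x \<in> V'" using U Z by blast
        have "V' \<subseteq> Z" using V V' x Z disj by blast
        thus "x \<in> \<Union>{V\<in>\<pi>. V \<subseteq> Z}" using V' by blast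
      qed auto
      show "disjnt V W" if "V \<in> {V\<in>\<pi>. V \<subseteq> Z}" "W \<in> {V\<in>\<pi>. V \<subseteq> Z}" "V \<noteq> W" for V W
        using that partition_on_block_unique[OF p] by (auto simp: disjnt_def)
      show "{} \<notin> {V\<in>\<pi>. V \<subseteq> Z}"
        using partition_onD3[OF p] by auto
    qed
    thus ?case by auto
  next
    case (5 c)
    thus ?case by auto
  qed
  finally show ?thesis by simp
qed

lemma sum_Pow_card:
  fixes g :: "nat \<Rightarrow> 'b::comm_semiring_1"
  assumes "finite A"
  shows "(\<Sum>B\<in>Pow A. g (card B)) = (\<Sum>j\<le>card A. of_nat (card A choose j) * g j)"
proof -
  have "(\<Sum>B\<in>Pow A. g (card B)) =
        (\<Sum>j\<le>card A. \<Sum>B | B \<in> Pow A \<and> card B = j. g (card B))"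
    using assms by (intro sum.group[symmetric]) (auto intro: card_mono)
  also have "\<dots> = (\<Sum>j\<le>card A. of_nat (card A choose j) * g j)"
  proof (rule sum.cong)
    fix j
    have "(\<Sum>B | B \<in> Pow A \<and> card B = j. g (card B)) = (\<Sum>B | B \<subseteq> A \<and> card B = j. g j)"
      by (rule sum.cong) auto
    thus "(\<Sum>B | B \<in> Pow A \<and> card B = j. g (card B)) = of_nat (card A choose j) * g j"
      using n_subsets[OF assms, of j] by simp
  qed simp
  finally show ?thesis .
qed

section \<open>Exponential generating functions of set partitions\<close>

lemma fps_nth_power_Suc_deriv:
  fixes f :: "'b::comm_semiring_1 fps"
  shows "of_nat (Suc n) * fps_nth (f ^ Suc r) (Suc n) =
         of_nat (Suc r) * fps_nth (fps_deriv f * f ^ r) n"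
proof -
  have "fps_deriv (f ^ Suc r) = of_nat (Suc r) * (fps_deriv f * f ^ r)"
    by (subst fps_deriv_power') (simp add: algebra_simps del: of_nat_Suc)
  hence "fps_nth (fps_deriv (f ^ Suc r)) n = of_nat (Suc r) * fps_nth (fps_deriv f * f ^ r) n"
    by (simp add: fps_of_nat[symmetric] del: of_nat_Suc)
  thus ?thesis by (simp del: of_nat_Suc power_Suc)
qed

text \<open>The exponential formula: \<open>f\<close> generates one block and f^r / r! an unordered
  collection of r blocks. Removing the block of a distinguished point is the rule (f^(s+1))' = (s +
  1) f' f^s, where f' generates that block without its point.\<close>

lemma sum_partition_on_fixed_card:
  fixes c :: "nat \<Rightarrow> 'b::field_char_0"
  assumes "finite A"
  defines "f \<equiv> Abs_fps (\<lambda>k. if k = 0 then 0 else c k / fact k)"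
  shows "(\<Sum>\<pi> | partition_on A \<pi> \<and> card \<pi> = r. \<Prod>V\<in>\<pi>. c (card V)) =
         fact (card A) / fact r * fps_nth (f ^ r) (card A)"
  using assms(1)
proof (induction "card A" arbitrary: A r rule: less_induct)
  case less
  show ?case
  proof (cases "A = {}")
    case True
    have "f $ 0 = 0" by (simp add: f_def)
    moreover have "{\<pi>. partition_on A \<pi> \<and> card \<pi> = r} = (if r = 0 then {{}} else {})"
      using True by (auto simp: partition_on_empty)
    ultimately show ?thesis
      using True by (cases "r = 0") (simp_all only: fps_nth_power_0, simp_all)
  next
    case False
    then obtain a A' where A: "A = insert a A'" and a: "a \<notin> A'"
      by (metis insertI1 mk_disjoint_insert ex_in_conv)
    have fin: "finite A'" using less.prems A by simp
    define n where "n = card A'"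
    have cardA: "card A = Suc n" using A a fin by (simp add: n_def)
    show ?thesis
    proof (cases r)
      case 0
      have none: "{\<pi>. partition_on A \<pi> \<and> card \<pi> = r} = {}"
        using 0 False less.prems finite_elements by (fastforce simp: partition_on_def)
      show ?thesis unfolding none using 0 cardA by simp
    next
      case (Suc s)
      define h where "h \<pi> = (if card \<pi> = r then \<Prod>V\<in>\<pi>. c (card V) else 0)" for \<pi> :: "'a set set"
      have step: "(\<Sum>\<pi> | partition_on (A' - B) \<pi>. h (insert (insert a B) \<pi>)) =
          c (Suc (card B)) * (fact (n - card B) / fact s * fps_nth (f ^ s) (n - card B))"
        if B: "B \<in> Pow A'" for B
      proof -
        have finB: "finite B" using B fin finite_subset by blast
        have "a \<notin> B" using B a by blast
        hence cB: "card (A' - B) = n - card B" "card (insert a B) = Suc (card B)"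
          using B finB by (auto simp: n_def card_Diff_subset)
        have "(\<Sum>\<pi> | partition_on (A' - B) \<pi>. h (insert (insert a B) \<pi>)) =
            (\<Sum>\<pi> | partition_on (A' - B) \<pi>.
               if card \<pi> = s then c (Suc (card B)) * (\<Prod>V\<in>\<pi>. c (card V)) else 0)"
        proof (rule sum.cong)
          fix \<pi> assume "\<pi> \<in> {\<pi>. partition_on (A' - B) \<pi>}"
          hence p: "partition_on (A' - B) \<pi>" by simp
          have f\<pi>: "finite \<pi>" using p fin finite_elements by blast
          have "insert a B \<notin> \<pi>" using partition_onD1[OF p] a by blast
          thus "h (insert (insert a B) \<pi>) =
              (if card \<pi> = s then c (Suc (card B)) * (\<Prod>V\<in>\<pi>. c (card V)) else 0)"
            using f\<pi> cB by (simp add: h_def Suc)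
        qed simp
        also have "\<dots> = (\<Sum>\<pi> | partition_on (A' - B) \<pi> \<and> card \<pi> = s.
               c (Suc (card B)) * (\<Prod>V\<in>\<pi>. c (card V)))"
          using finitely_many_partition_on[of "A' - B"] fin by (simp add: sum_Collect_conj)
        also have "\<dots> = c (Suc (card B)) *
             (\<Sum>\<pi> | partition_on (A' - B) \<pi> \<and> card \<pi> = s. \<Prod>V\<in>\<pi>. c (card V))"
          by (simp add: sum_distrib_left)
        also have "(\<Sum>\<pi> | partition_on (A' - B) \<pi> \<and> card \<pi> = s. \<Prod>V\<in>\<pi>. c (card V)) =
             fact (card (A' - B)) / fact s * fps_nth (f ^ s) (card (A' - B))"
          using cardA cB fin by (intro less.hyps) auto
        finally show ?thesis using cB by simp
      qed
      have "(\<Sum>\<pi> | partition_on A \<pi> \<and> card \<pi> = r. \<Prod>V\<in>\<pi>. c (card V)) =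
            (\<Sum>\<pi> | partition_on A \<pi>. h \<pi>)"
        unfolding h_def by (rule sum_Collect_conj[OF finitely_many_partition_on[OF less.prems]])
      also have "\<dots> = (\<Sum>B\<in>Pow A'. c (Suc (card B)) *
            (fact (n - card B) / fact s * fps_nth (f ^ s) (n - card B)))"
        unfolding A sum_partition_on_insert[OF fin a] by (rule sum.cong[OF refl step])
      also have "\<dots> = (\<Sum>j\<le>n. of_nat (n choose j) * (c (Suc j) *
            (fact (n - j) / fact s * fps_nth (f ^ s) (n - j))))"
        unfolding n_def by (rule sum_Pow_card[OF fin])
      also have "\<dots> = (\<Sum>j\<le>n. fact n / fact s * (fps_nth (fps_deriv f) j * fps_nth (f ^ s) (n - j)))"
      proof (rule sum.cong)
        fix j assume "j \<in> {..n}"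
        hence "of_nat (n choose j) = (fact n / (fact j * fact (n - j)) :: 'b)"
          by (intro binomial_fact) auto
        moreover have "fps_nth (fps_deriv f) j = c (Suc j) / fact j"
          by (simp add: f_def divide_simps del: of_nat_Suc)
        ultimately show "of_nat (n choose j) * (c (Suc j) *
            (fact (n - j) / fact s * fps_nth (f ^ s) (n - j))) =
            fact n / fact s * (fps_nth (fps_deriv f) j * fps_nth (f ^ s) (n - j))"
          by simp
      qed simp
      also have "\<dots> = fact n / fact s * fps_nth (fps_deriv f * f ^ s) n"
        by (simp add: fps_mult_nth sum_distrib_left atMost_atLeast0)
      also have "fps_nth (fps_deriv f * f ^ s) n = of_nat (Suc n) / of_nat (Suc s) * fps_nth (f ^ Suc s) (Suc n)"
        using fps_nth_power_Suc_deriv[of n f s] by (simp add: field_simps del: of_nat_Suc power_Suc)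
      finally show ?thesis using cardA Suc by (simp add: field_simps del: of_nat_Suc)
    qed
  qed
qed

text \<open>The weight (-1)^(r-1) (r-1)! turns f^r / r! into (-1)^(r-1) f^r / r, the terms of log (1
  + f). Passing to the derivative of the logarithm leaves a geometric series.\<close>

lemma sum_partition_on_log:
  fixes c :: "nat \<Rightarrow> 'b::field_char_0"
  assumes "finite A" "card A = Suc n"
  defines "f \<equiv> Abs_fps (\<lambda>k. if k = 0 then 0 else c k / fact k)"
  shows "(\<Sum>\<pi> | partition_on A \<pi>. (-1) ^ (card \<pi> - 1) * fact (card \<pi> - 1) * (\<Prod>V\<in>\<pi>. c (card V))) =
         fact n * fps_nth (fps_deriv f / (1 + f)) n"
proof -
  have f0: "f $ 0 = 0" by (simp add: f_def)
  have card_le: "card \<pi> \<in> {1..Suc n}" if p: "partition_on A \<pi>" for \<pi>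
  proof -
    have fp: "finite \<pi>" using p assms(1) finite_elements by blast
    have fV: "finite V" if "V \<in> \<pi>" for V
      using partition_on_block_subset[OF p that] assms(1) by (rule finite_subset)
    have "card A = sum card \<pi>"
      using p fV by (rule product_partition)
    moreover have "(\<Sum>V\<in>\<pi>. 1) \<le> sum card \<pi>"
    proof (rule sum_mono)
      fix V assume V: "V \<in> \<pi>"
      hence "V \<noteq> {}" using partition_onD3[OF p] by blast
      thus "1 \<le> card V" using fV[OF V] by (simp add: Suc_le_eq card_gt_0_iff)
    qed
    moreover have "\<pi> \<noteq> {}" using p assms(2) by (auto simp: partition_on_def)
    ultimately show ?thesis using assms(2) fp by (auto simp: Suc_le_eq card_gt_0_iff)
  qed
  have "(\<Sum>\<pi> | partition_on A \<pi>. (-1) ^ (card \<pi> - 1) * fact (card \<pi> - 1) * (\<Prod>V\<in>\<pi>. c (card V))) =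
    (\<Sum>r\<in>{1..Suc n}. \<Sum>\<pi> | \<pi> \<in> {\<pi>. partition_on A \<pi>} \<and> card \<pi> = r.
       (-1) ^ (card \<pi> - 1) * fact (card \<pi> - 1) * (\<Prod>V\<in>\<pi>. c (card V)))"
    using finitely_many_partition_on[OF assms(1)] card_le by (intro sum.group[symmetric]) auto
  also have "\<dots> = (\<Sum>r\<in>{1..Suc n}. (-1) ^ (r - 1) * fact (r - 1) *
       (\<Sum>\<pi> | partition_on A \<pi> \<and> card \<pi> = r. \<Prod>V\<in>\<pi>. c (card V)))"
    unfolding sum_distrib_left by (intro sum.cong) auto
  also have "\<dots> = (\<Sum>r\<in>{1..Suc n}. (-1) ^ (r - 1) * fact (r - 1) *
       (fact (Suc n) / fact r * fps_nth (f ^ r) (Suc n)))"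
    unfolding f_def using sum_partition_on_fixed_card[OF assms(1), of c] assms(2) by simp
  also have "\<dots> = (\<Sum>r\<le>n. (-1) ^ r * fact r *
       (fact (Suc n) / fact (Suc r) * fps_nth (f ^ Suc r) (Suc n)))"
    by (rule sum.reindex_bij_witness[where i = Suc and j = "\<lambda>r. r - 1"]) auto
  also have "\<dots> = (\<Sum>r\<le>n. fact n * fps_nth (fps_deriv f * (-f) ^ r) n)"
  proof (rule sum.cong)
    fix r
    note fps_nth_power_Suc_deriv[of n f r]
    moreover have "(-f) ^ r = fps_const ((-1) ^ r) * f ^ r"
      by (subst power_minus) (simp flip: fps_const_power)
    hence "fps_deriv f * (-f) ^ r = fps_const ((-1) ^ r) * (fps_deriv f * f ^ r)"
      by (simp only: mult_ac)
    hence "fps_nth (fps_deriv f * (-f) ^ r) n = (-1) ^ r * fps_nth (fps_deriv f * f ^ r) n"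
      by (simp only: fps_mult_left_const_nth)
    ultimately show "(-1) ^ r * fact r * (fact (Suc n) / fact (Suc r) * fps_nth (f ^ Suc r) (Suc n)) =
        fact n * fps_nth (fps_deriv f * (-f) ^ r) n"
      by (simp add: field_simps del: of_nat_Suc power_Suc)
  qed simp
  also have "\<dots> = fact n * fps_nth (fps_deriv f * (\<Sum>r\<le>n. (-f) ^ r)) n"
    by (simp add: sum_distrib_left fps_sum_nth)
  \<comment> \<open>The geometric sum stops at \<open>n\<close>; its remainder carries
    \<open>f ^ Suc n\<close>, which has no coefficient of order at most \<open>n\<close>.\<close>
  also have "(\<Sum>r\<le>n. (-f) ^ r) = (1 - (-f) ^ Suc n) / (1 + f)"
  proof -
    have "(\<Sum>r\<le>n. (-f) ^ r) * (1 + f) = 1 - (-f) ^ Suc n"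
      using one_diff_power_eq[of "-f" "Suc n"] by (simp only: lessThan_Suc_atMost mult.commute) simp
    moreover have "(1 + f) $ 0 \<noteq> 0" using f0 by simp
    ultimately show ?thesis
      by (metis fps_divide_times_eq nonzero_mult_div_cancel_right fps_nonzero_nth)
  qed
  also have "fps_deriv f * ((1 - (-f) ^ Suc n) / (1 + f)) =
      fps_deriv f / (1 + f) - (-f) ^ Suc n * (fps_deriv f / (1 + f))"
    using f0 by (simp add: fps_divide_unit algebra_simps)
  also have "fps_nth \<dots> n = fps_nth (fps_deriv f / (1 + f)) n"
  proof -
    have "fps_nth ((-f) ^ Suc n) k = 0" if "k \<le> n" for k
      using that f0 by (intro startsby_zero_power_prefix[rule_format]) auto
    hence "fps_nth ((-f) ^ Suc n * (fps_deriv f / (1 + f))) n = 0"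
      unfolding fps_mult_nth by (intro sum.neutral) auto
    thus ?thesis by simp
  qed
  finally show ?thesis .
qed

section \<open>Noncrossing partitions\<close>

lemma noncrossingD:
  "noncrossing \<pi> \<Longrightarrow> V \<in> \<pi> \<Longrightarrow> W \<in> \<pi> \<Longrightarrow> V \<noteq> W \<Longrightarrow>
     a \<in> V \<Longrightarrow> b \<in> W \<Longrightarrow> c \<in> V \<Longrightarrow> d \<in> W \<Longrightarrow> a < b \<Longrightarrow> b < c \<Longrightarrow> c < d \<Longrightarrow> False"
  unfolding noncrossing_def by blast

lemma noncrossingI:
  "(\<And>V W a b c d. V \<in> \<pi> \<Longrightarrow> W \<in> \<pi> \<Longrightarrow> V \<noteq> W \<Longrightarrow>
     a \<in> V \<Longrightarrow> b \<in> W \<Longrightarrow> c \<in> V \<Longrightarrow> d \<in> W \<Longrightarrow> a < b \<Longrightarrow> b < c \<Longrightarrow> c < d \<Longrightarrow> False) \<Longrightarrow>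
   noncrossing \<pi>"
  unfolding noncrossing_def by blast

lemma noncrossing_subset:
  assumes "noncrossing \<pi>" "\<rho> \<subseteq> \<pi>"
  shows "noncrossing \<rho>"
proof (rule noncrossingI)
  fix V W a b c d
  assume "V \<in> \<rho>" "W \<in> \<rho>" "V \<noteq> W"
    "a \<in> V" "b \<in> W" "c \<in> V" "d \<in> W" "a < b" "b < c" "c < d"
  with assms show False by (intro noncrossingD[of \<pi> V W a b c d]) (auto simp only: subset_iff)
qed

section \<open>Noncrossing partitions around the block of the smallest point\<close>

definition unseparated :: "nat set \<Rightarrow> nat set set \<Rightarrow> bool" where
  "unseparated B \<pi> \<longleftrightarrow> (\<forall>V\<in>\<pi>. \<forall>x\<in>V. \<forall>y\<in>V. \<forall>b\<in>B. \<not> (x < b \<and> b < y))"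

lemma unseparatedD:
  "unseparated B \<pi> \<Longrightarrow> V \<in> \<pi> \<Longrightarrow> x \<in> V \<Longrightarrow> y \<in> V \<Longrightarrow> b \<in> B \<Longrightarrow> \<not> (x < b \<and> b < y)"
  unfolding unseparated_def by blast

text \<open>If \<open>a\<close> is smaller than all other points, these are the noncrossing partitions
  having \<open>insert a B\<close> as the block of \<open>a\<close>, with that block removed.\<close>

definition nc_sum_around :: "(nat \<Rightarrow> 'b::comm_semiring_1) \<Rightarrow> nat set \<Rightarrow> nat set \<Rightarrow> 'b" where
  "nc_sum_around \<kappa> B X =
     (\<Sum>\<pi> | partition_on X \<pi> \<and> noncrossing \<pi> \<and> unseparated B \<pi>. \<Prod>V\<in>\<pi>. \<kappa> (card V))"

abbreviation nc_sum :: "(nat \<Rightarrow> 'b::comm_semiring_1) \<Rightarrow> nat set \<Rightarrow> 'b" where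
  "nc_sum \<kappa> \<equiv> nc_sum_around \<kappa> {}"

lemma nc_sum_empty [simp]: "nc_sum \<kappa> {} = 1"
proof -
  have "{\<pi>. partition_on {} \<pi> \<and> noncrossing \<pi> \<and> unseparated {} \<pi>} = {{}}"
    by (auto simp: partition_on_empty noncrossing_def unseparated_def)
  thus ?thesis by (simp add: nc_sum_around_def)
qed

text \<open>A crossing of V with \<open>insert a B\<close> puts a point of \<open>insert a B\<close>
  between two points of V, and \<open>a\<close> is too small to be that point. Conversely, x < b < y
  with x, y in V and b in \<open>B\<close> becomes a crossing when preceded by
  \<open>a\<close>.\<close>

lemma noncrossing_insert_first:
  assumes p: "partition_on X \<pi>" and a: "\<And>x. x \<in> X \<union> B \<Longrightarrow> a < x" and B: "B \<inter> X = {}"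
  shows "noncrossing (insert (insert a B) \<pi>) \<longleftrightarrow> noncrossing \<pi> \<and> unseparated B \<pi>"
proof
  assume nc: "noncrossing (insert (insert a B) \<pi>)"
  have "noncrossing \<pi>" using nc by (rule noncrossing_subset) blast
  moreover have "unseparated B \<pi>"
    unfolding unseparated_def
  proof (intro ballI notI)
    fix V x y b assume *: "V \<in> \<pi>" "x \<in> V" "y \<in> V" "b \<in> B" "x < b \<and> b < y"
    have "V \<subseteq> X" using p *(1) by (rule partition_on_block_subset)
    hence "a < x" "V \<noteq> insert a B" using a *(2,4) B by blast+
    thus False
      using noncrossingD[OF nc, of "insert a B" V a x b y] * by auto
  qed
  ultimately show "noncrossing \<pi> \<and> unseparated B \<pi>" ..
next
  assume *: "noncrossing \<pi> \<and> unseparated B \<pi>"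
  have sub: "V \<subseteq> X" if "V \<in> \<pi>" for V using p that by (rule partition_on_block_subset)
  have 1: False if "V \<in> \<pi>" "x \<in> V" "y \<in> V" "b \<in> insert a B" "x < b" "b < y" for V x y b
    using * that sub[OF that(1)] a[of x] unfolding unseparated_def by (auto dest: less_asym)
  show "noncrossing (insert (insert a B) \<pi>)"
  proof (rule noncrossingI)
    fix V W x b y b' assume **: "V \<in> insert (insert a B) \<pi>" "W \<in> insert (insert a B) \<pi>" "V \<noteq> W"
      "x \<in> V" "b \<in> W" "y \<in> V" "b' \<in> W" "x < b" "b < y" "y < b'"
    show False
    proof (cases "V \<in> \<pi>")
      case True
      show False
      proof (cases "W \<in> \<pi>")
        case W: True
        show False
          by (rule noncrossingD[of \<pi> V W x b y b']) (use * True W ** in auto)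
      next
        case False
        thus False using ** True 1[of V x y b] by auto
      qed
    next
      case False
      thus False using ** 1[of W b b' y] by auto
    qed
  qed
qed

lemma nc_sum_insert_first:
  assumes X: "finite X" and a: "\<And>x. x \<in> X \<Longrightarrow> a < x"
  shows "nc_sum \<kappa> (insert a X) = (\<Sum>B\<in>Pow X. \<kappa> (Suc (card B)) * nc_sum_around \<kappa> B (X - B))"
proof -
  have aX: "a \<notin> X" using a by blast
  define h where "h \<pi> = (if noncrossing \<pi> then \<Prod>V\<in>\<pi>. \<kappa> (card V) else 0)" for \<pi>
  have "nc_sum \<kappa> (insert a X) = (\<Sum>\<pi> | partition_on (insert a X) \<pi>. h \<pi>)"
    unfolding nc_sum_around_def h_def unseparated_def
    using sum_Collect_conj[OF finitely_many_partition_on, of "insert a X" _ noncrossing] X by simp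
  also have "\<dots> = (\<Sum>B\<in>Pow X. \<Sum>\<pi> | partition_on (X - B) \<pi>. h (insert (insert a B) \<pi>))"
    by (rule sum_partition_on_insert[OF X aX])
  also have "\<dots> = (\<Sum>B\<in>Pow X. \<kappa> (Suc (card B)) * nc_sum_around \<kappa> B (X - B))"
  proof (rule sum.cong)
    fix B assume "B \<in> Pow X"
    hence B: "B \<subseteq> X" by simp
    have aB: "a \<notin> B" and finB: "finite B" using B aX X finite_subset by blast+
    have "(\<Sum>\<pi> | partition_on (X - B) \<pi>. h (insert (insert a B) \<pi>)) =
        (\<Sum>\<pi> | partition_on (X - B) \<pi>.
           if noncrossing \<pi> \<and> unseparated B \<pi> then \<kappa> (Suc (card B)) * (\<Prod>V\<in>\<pi>. \<kappa> (card V)) else 0)"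
    proof (rule sum.cong)
      fix \<pi> assume "\<pi> \<in> {\<pi>. partition_on (X - B) \<pi>}"
      hence p: "partition_on (X - B) \<pi>" by simp
      have f\<pi>: "finite \<pi>" using p X finite_elements by blast
      have "insert a B \<notin> \<pi>" using partition_onD1[OF p] aX by blast
      moreover have "noncrossing (insert (insert a B) \<pi>) \<longleftrightarrow> noncrossing \<pi> \<and> unseparated B \<pi>"
        using B a by (intro noncrossing_insert_first[OF p]) auto
      ultimately show "h (insert (insert a B) \<pi>) =
          (if noncrossing \<pi> \<and> unseparated B \<pi> then \<kappa> (Suc (card B)) * (\<Prod>V\<in>\<pi>. \<kappa> (card V)) else 0)"
        using f\<pi> finB aB by (simp add: h_def)
    qed simp
    also have "\<dots> = \<kappa> (Suc (card B)) * nc_sum_around \<kappa> B (X - B)"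
      unfolding nc_sum_around_def sum_distrib_left
      by (rule sum_Collect_conj[symmetric]) (use X in \<open>simp add: finitely_many_partition_on\<close>)
    finally show "(\<Sum>\<pi> | partition_on (X - B) \<pi>. h (insert (insert a B) \<pi>)) =
        \<kappa> (Suc (card B)) * nc_sum_around \<kappa> B (X - B)" .
  qed simp
  finally show ?thesis .
qed

text \<open>No block may straddle \<open>b\<close>, so the partition falls into one on each side. On
  the left the points of \<open>B\<close> impose nothing, since they lie beyond \<open>b\<close>; on
  the right \<open>b\<close> itself imposes nothing.\<close>

lemma nc_sum_around_split:
  assumes fin: "finite X" "finite Y"
    and X: "\<And>x. x \<in> X \<Longrightarrow> x < b" and Y: "\<And>y. y \<in> Y \<union> B \<Longrightarrow> b < y"
  shows "nc_sum_around \<kappa> (insert b B) (X \<union> Y) = nc_sum \<kappa> X * nc_sum_around \<kappa> B Y"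
proof -
  have disj: "X \<inter> Y = {}" using X Y by (meson IntE UnI1 disjoint_iff less_asym)
  define split where "split \<pi> \<longleftrightarrow> (\<forall>V\<in>\<pi>. V \<subseteq> X \<or> V \<subseteq> Y)" for \<pi>
  define P where "P \<pi> \<longleftrightarrow> noncrossing \<pi> \<and> unseparated (insert b B) \<pi>" for \<pi>
  define h where "h \<pi> = (if P \<pi> then \<Prod>V\<in>\<pi>. \<kappa> (card V) else 0)" for \<pi>
  have split: "split \<pi>" if p: "partition_on (X \<union> Y) \<pi>" and "P \<pi>" for \<pi>
    unfolding split_def
  proof (rule ballI, rule ccontr)
    fix V assume V: "V \<in> \<pi>" and "\<not> (V \<subseteq> X \<or> V \<subseteq> Y)"
    then obtain x y where "x \<in> V" "y \<in> V" "x \<in> X" "y \<in> Y"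
      using partition_on_block_subset[OF p V] by blast
    moreover from this have "x < b" "b < y" using X Y by auto
    ultimately show False using \<open>P \<pi>\<close> V unfolding P_def unseparated_def by blast
  qed
  have P: "P (\<rho> \<union> \<sigma>) \<longleftrightarrow> noncrossing \<rho> \<and> (noncrossing \<sigma> \<and> unseparated B \<sigma>)"
    if p: "partition_on X \<rho>" "partition_on Y \<sigma>" for \<rho> \<sigma>
  proof
    assume *: "P (\<rho> \<union> \<sigma>)"
    hence nc: "noncrossing (\<rho> \<union> \<sigma>)" by (simp add: P_def)
    have "noncrossing \<rho>" "noncrossing \<sigma>"
      by (rule noncrossing_subset[OF nc]; blast)+
    moreover have "unseparated B \<sigma>"
      unfolding unseparated_def
    proof (intro ballI)
      fix V x y c assume "V \<in> \<sigma>" "x \<in> V" "y \<in> V" "c \<in> B"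
      thus "\<not> (x < c \<and> c < y)"
        using * by (intro unseparatedD[of "insert b B" "\<rho> \<union> \<sigma>" V]) (simp_all add: P_def)
    qed
    ultimately show "noncrossing \<rho> \<and> (noncrossing \<sigma> \<and> unseparated B \<sigma>)" by blast
  next
    assume *: "noncrossing \<rho> \<and> (noncrossing \<sigma> \<and> unseparated B \<sigma>)"
    have \<rho>: "x < b" if "V \<in> \<rho>" "x \<in> V" for V x
      using X partition_on_block_subset[OF p(1) that(1)] that(2) by blast
    have \<sigma>: "b < y" if "V \<in> \<sigma>" "y \<in> V" for V y
      using Y partition_on_block_subset[OF p(2) that(1)] that(2) by blast
    have "noncrossing (\<rho> \<union> \<sigma>)"
    proof (rule noncrossingI)
      fix V W x w y w' assume **: "V \<in> \<rho> \<union> \<sigma>" "W \<in> \<rho> \<union> \<sigma>" "V \<noteq> W"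
        "x \<in> V" "w \<in> W" "y \<in> V" "w' \<in> W" "x < w" "w < y" "y < w'"
      consider "V \<in> \<rho>" "W \<in> \<rho>" | "V \<in> \<sigma>" "W \<in> \<sigma>" | "V \<in> \<rho>" "W \<in> \<sigma>" | "V \<in> \<sigma>" "W \<in> \<rho>"
        using ** by blast
      thus False
      proof cases
        case 1
        show False by (rule noncrossingD[of \<rho> V W x w y w']) (use * ** 1 in auto)
      next
        case 2
        show False by (rule noncrossingD[of \<sigma> V W x w y w']) (use * ** 2 in auto)
      next
        case 3 thus False using \<rho>[of V y] \<sigma>[of W w] ** by simp
      next
        case 4 thus False using \<rho>[of W w'] \<sigma>[of V y] ** by simp
      qed
    qed
    moreover have "unseparated (insert b B) (\<rho> \<union> \<sigma>)"
      unfolding unseparated_def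
    proof (intro ballI notI)
      fix V x y c assume **: "V \<in> \<rho> \<union> \<sigma>" "x \<in> V" "y \<in> V" "c \<in> insert b B" "x < c \<and> c < y"
      have "b \<le> c" using **(4) Y[of c] by auto
      show False
      proof (cases "V \<in> \<rho>")
        case True
        thus False using \<rho>[of V y] ** \<open>b \<le> c\<close> by simp
      next
        case False
        hence V: "V \<in> \<sigma>" using ** by simp
        hence "c \<noteq> b" using \<sigma>[of V x] ** by auto
        thus False using * ** V unfolding unseparated_def by blast
      qed
    qed
    ultimately show "P (\<rho> \<union> \<sigma>)" unfolding P_def ..
  qed
  have "nc_sum_around \<kappa> (insert b B) (X \<union> Y) = (\<Sum>\<pi> | partition_on (X \<union> Y) \<pi> \<and> split \<pi>. h \<pi>)"
  proof -
    have fin': "finite {\<pi>. partition_on (X \<union> Y) \<pi>}"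
      using fin by (intro finitely_many_partition_on) auto
    have "nc_sum_around \<kappa> (insert b B) (X \<union> Y) = (\<Sum>\<pi> | partition_on (X \<union> Y) \<pi>. h \<pi>)"
      unfolding nc_sum_around_def h_def P_def by (rule sum_Collect_conj[OF fin'])
    also have "\<dots> = (\<Sum>\<pi> | partition_on (X \<union> Y) \<pi> \<and> split \<pi>. h \<pi>)"
      using fin' split by (intro sum.mono_neutral_right) (auto simp: h_def)
    finally show ?thesis .
  qed
  also have "\<dots> = (\<Sum>\<rho> | partition_on X \<rho>. \<Sum>\<sigma> | partition_on Y \<sigma>. h (\<rho> \<union> \<sigma>))"
    unfolding split_def by (rule sum_partition_on_Un[OF fin disj])
  also have "\<dots> = (\<Sum>\<rho> | partition_on X \<rho>. \<Sum>\<sigma> | partition_on Y \<sigma>.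
      (if noncrossing \<rho> then \<Prod>V\<in>\<rho>. \<kappa> (card V) else 0) *
      (if noncrossing \<sigma> \<and> unseparated B \<sigma> then \<Prod>V\<in>\<sigma>. \<kappa> (card V) else 0))"
  proof (intro sum.cong refl)
    fix \<rho> \<sigma> assume "\<rho> \<in> {\<rho>. partition_on X \<rho>}" "\<sigma> \<in> {\<sigma>. partition_on Y \<sigma>}"
    hence p: "partition_on X \<rho>" "partition_on Y \<sigma>" by auto
    have "V \<notin> \<sigma>" if "V \<in> \<rho>" for V
    proof
      assume "V \<in> \<sigma>"
      hence "V \<subseteq> X \<inter> Y" using p that partition_on_block_subset by blast
      thus False using disj partition_onD3[OF p(1)] that by auto
    qed
    hence "\<rho> \<inter> \<sigma> = {}" by blast
    moreover have "finite \<rho>" "finite \<sigma>" using p fin finite_elements by blast+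
    ultimately show "h (\<rho> \<union> \<sigma>) = (if noncrossing \<rho> then \<Prod>V\<in>\<rho>. \<kappa> (card V) else 0) *
      (if noncrossing \<sigma> \<and> unseparated B \<sigma> then \<Prod>V\<in>\<sigma>. \<kappa> (card V) else 0)"
      by (simp add: h_def P[OF p] prod.union_disjoint)
  qed
  also have "\<dots> = nc_sum \<kappa> X * nc_sum_around \<kappa> B Y"
  proof -
    have "nc_sum \<kappa> X = (\<Sum>\<rho> | partition_on X \<rho>. if noncrossing \<rho> then \<Prod>V\<in>\<rho>. \<kappa> (card V) else 0)"
      unfolding nc_sum_around_def unseparated_def
      by (simp add: sum_Collect_conj[OF finitely_many_partition_on[OF fin(1)]])
    moreover have "nc_sum_around \<kappa> B Y = (\<Sum>\<sigma> | partition_on Y \<sigma>.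
        if noncrossing \<sigma> \<and> unseparated B \<sigma> then \<Prod>V\<in>\<sigma>. \<kappa> (card V) else 0)"
      unfolding nc_sum_around_def
      by (rule sum_Collect_conj[OF finitely_many_partition_on[OF fin(2)]])
    ultimately show ?thesis by (simp only: sum_product)
  qed
  finally show ?thesis .
qed

text \<open>The block of a smallest point is read from left to right: \<open>j\<close> of its points
  lie before \<open>l\<close>, and \<open>B\<close> is the rest of the block.\<close>

definition nc_sum_shifted :: "(nat \<Rightarrow> 'b::comm_semiring_1) \<Rightarrow> nat \<Rightarrow> nat \<Rightarrow> nat \<Rightarrow> 'b" where
  "nc_sum_shifted \<kappa> j l u =
     (\<Sum>B\<in>Pow {l..<u}. \<kappa> (card B + j) * nc_sum_around \<kappa> B ({l..<u} - B))"

lemma nc_sum_Suc: "l < u \<Longrightarrow> nc_sum \<kappa> {l..<u} = nc_sum_shifted \<kappa> 1 (Suc l) u"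
proof -
  assume "l < u"
  hence "{l..<u} = insert l {Suc l..<u}" by auto
  moreover have "nc_sum \<kappa> (insert l {Suc l..<u}) = nc_sum_shifted \<kappa> 1 (Suc l) u"
    by (subst nc_sum_insert_first) (auto simp: nc_sum_shifted_def)
  ultimately show ?thesis by simp
qed

text \<open>Either the block is complete, or \<open>b\<close> is its next point: the gap before
  \<open>b\<close> then carries an independent noncrossing partition, and the count \<open>j\<close>
  goes up by one.\<close>

lemma nc_sum_shifted_rec:
  "nc_sum_shifted \<kappa> j l u =
     \<kappa> j * nc_sum \<kappa> {l..<u} +
     (\<Sum>b\<in>{l..<u}. nc_sum \<kappa> {l..<b} * nc_sum_shifted \<kappa> (Suc j) (Suc b) u)"
proof -
  define t where "t B = \<kappa> (card B + j) * nc_sum_around \<kappa> B ({l..<u} - B)" for B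
  have "nc_sum_shifted \<kappa> j l u = t {} + sum t (Pow {l..<u} - {{}})"
    unfolding nc_sum_shifted_def t_def by (subst sum.remove[of _ "{}"]) auto
  also have "sum t (Pow {l..<u} - {{}}) =
      (\<Sum>(b, B)\<in>(SIGMA b:{l..<u}. Pow {Suc b..<u}). t (insert b B))"
  proof (rule sum.reindex_bij_witness[where i = "\<lambda>(b, B). insert b B"
        and j = "\<lambda>B. (Min B, B - {Min B})"], goal_cases)
    case (1 B)
    hence "finite B" "B \<noteq> {}" using finite_subset by auto
    hence "Min B \<in> B" by (rule Min_in)
    thus ?case by auto
  next
    case (2 B)
    hence B: "finite B" "B \<noteq> {}" "B \<subseteq> {l..<u}" using finite_subset by auto
    have "Min B < x" if "x \<in> B" "x \<noteq> Min B" for x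
      using Min_le[OF B(1) that(1)] that(2) by simp
    hence "B - {Min B} \<subseteq> {Suc (Min B)..<u}" using B(3) by (fastforce simp: Suc_le_eq)
    moreover have "Min B \<in> {l..<u}" using Min_in[OF B(1,2)] B(3) by blast
    ultimately show ?case by simp
  next
    case (3 c)
    then obtain b B where c: "c = (b, B)" "b \<in> {l..<u}" "B \<subseteq> {Suc b..<u}" by auto
    hence "finite B" using finite_subset by blast
    hence "Min (insert b B) = b" using c by (intro Min_eqI) auto
    thus ?case using c by auto
  next
    case (4 c)
    thus ?case by auto
  next
    case (5 B)
    hence "finite B" "B \<noteq> {}" using finite_subset by auto
    hence "Min B \<in> B" by (rule Min_in)
    thus ?case by (auto simp: insert_absorb)
  qed
  also have "\<dots> = (\<Sum>b\<in>{l..<u}. \<Sum>B\<in>Pow {Suc b..<u}. t (insert b B))"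
    by (subst sum.Sigma) auto
  also have "\<dots> = (\<Sum>b\<in>{l..<u}. nc_sum \<kappa> {l..<b} * nc_sum_shifted \<kappa> (Suc j) (Suc b) u)"
    unfolding nc_sum_shifted_def sum_distrib_left
  proof (intro sum.cong refl)
    fix b B assume b: "b \<in> {l..<u}" and "B \<in> Pow {Suc b..<u}"
    hence B: "B \<subseteq> {Suc b..<u}" by simp
    have "{l..<u} - insert b B = {l..<b} \<union> ({Suc b..<u} - B)" using b B by auto
    moreover have "nc_sum_around \<kappa> (insert b B) ({l..<b} \<union> ({Suc b..<u} - B)) =
        nc_sum \<kappa> {l..<b} * nc_sum_around \<kappa> B ({Suc b..<u} - B)"
      using B by (intro nc_sum_around_split) auto
    moreover have "card (insert b B) = Suc (card B)"
      using B finite_subset[OF B] by (subst card_insert_disjoint) auto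
    ultimately show "t (insert b B) =
        nc_sum \<kappa> {l..<b} * (\<kappa> (card B + Suc j) * nc_sum_around \<kappa> B ({Suc b..<u} - B))"
      by (simp add: t_def mult_ac)
  qed
  finally show ?thesis by (simp add: t_def)
qed

text \<open>The series \<open>\<Phi> j\<close> generates the sums
  \<open>nc_sum_shifted \<kappa> j\<close>: a block with s further points leaves s + 1 gaps, hence
  the terms \<kappa>_(s+j) w^s M^(s+1). The relation F_j = \<kappa>_j + u F_(j+1) between the tails
  mirrors \<open>nc_sum_shifted_rec\<close>.\<close>

theorem nc_sum_functional_equation:
  fixes \<kappa> :: "nat \<Rightarrow> 'b::idom"
  defines "M \<equiv> Abs_fps (\<lambda>n. nc_sum \<kappa> {0..<n})"
  shows "M = Abs_fps (\<lambda>n. if n = 0 then 1 else \<kappa> n) oo (fps_X * M)"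
    and "nc_sum \<kappa> {l..<l + n} = fps_nth M n"
proof -
  define F where "F j = Abs_fps (\<lambda>s. \<kappa> (s + j))" for j
  define \<Phi> where "\<Phi> j = M * (F j oo (fps_X * M))" for j
  have F: "F j = fps_const (\<kappa> j) + fps_X * F (Suc j)" for j
  proof (rule fps_ext)
    fix n show "F j $ n = (fps_const (\<kappa> j) + fps_X * F (Suc j)) $ n"
      by (cases n) (simp_all add: F_def)
  qed
  have FG: "F j oo (fps_X * M) = fps_const (\<kappa> j) + (fps_X * M) * (F (Suc j) oo (fps_X * M))" for j
    by (subst F) (simp add: fps_compose_add_distrib fps_compose_mult_distrib)
  have \<Phi>: "\<Phi> j = fps_const (\<kappa> j) * M + fps_X * (M * \<Phi> (Suc j))" for j
    unfolding \<Phi>_def by (subst FG) (simp add: algebra_simps)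
  \<comment> \<open>Both claims are proved together and for every left end \<open>l\<close>, because
    the gaps inside an interval start anywhere.\<close>
  have main: "(\<forall>l. nc_sum \<kappa> {l..<l + n} = M $ n) \<and> (\<forall>j l. nc_sum_shifted \<kappa> j l (l + n) = \<Phi> j $ n)" for n
  proof (induction n rule: less_induct)
    case (less n)
    have 1: "nc_sum \<kappa> {l..<l + n} = M $ n" for l
    proof (cases n)
      case 0
      thus ?thesis by (simp add: M_def)
    next
      case (Suc k)
      have "nc_sum \<kappa> {l..<l + n} = \<Phi> 1 $ k" for l
      proof -
        have "nc_sum \<kappa> {l..<l + n} = nc_sum_shifted \<kappa> 1 (Suc l) (Suc l + k)"
          using nc_sum_Suc[of l "l + n" \<kappa>] by (simp add: Suc)
        also have "\<dots> = \<Phi> 1 $ k"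
          using less.IH[of k] Suc by blast
        finally show ?thesis .
      qed
      \<comment> \<open>\<open>\<Phi> 1 $ k\<close> does not depend on \<open>l\<close>, and at l =
        0 the sum is \<open>M $ n\<close> by definition.\<close>
      from this[of l] this[of 0] show ?thesis by (simp add: M_def)
    qed
    have 2: "nc_sum_shifted \<kappa> j l (l + n) = \<Phi> j $ n" for j l
    proof -
      have "(\<Sum>b\<in>{l..<l+n}. nc_sum \<kappa> {l..<b} * nc_sum_shifted \<kappa> (Suc j) (Suc b) (l + n)) =
          (\<Sum>i<n. M $ i * \<Phi> (Suc j) $ (n - 1 - i))"
      proof (rule sum.reindex_bij_witness[where i = "\<lambda>i. l + i" and j = "\<lambda>b. b - l"])
        fix b assume b: "b \<in> {l..<l + n}"
        define i where "i = b - l"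
        have i: "b = l + i" "i < n" using b by (auto simp: i_def)
        hence eq: "l + n = Suc b + (n - 1 - i)" and less: "n - 1 - i < n" by simp_all
        have "nc_sum \<kappa> {l..<b} = M $ i"
          unfolding i(1) using less.IH[OF i(2)] by blast
        moreover have "nc_sum_shifted \<kappa> (Suc j) (Suc b) (l + n) = \<Phi> (Suc j) $ (n - 1 - i)"
          unfolding eq using less.IH[OF less] by blast
        ultimately show "M $ (b - l) * \<Phi> (Suc j) $ (n - 1 - (b - l)) =
            nc_sum \<kappa> {l..<b} * nc_sum_shifted \<kappa> (Suc j) (Suc b) (l + n)"
          by (simp add: i_def)
      qed auto
      also have "\<dots> = (fps_X * (M * \<Phi> (Suc j))) $ n"
        by (cases n) (simp_all only: fps_X_mult_nth fps_mult_nth[of M], simp_all add: lessThan_Suc_atMost atMost_atLeast0)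
      finally show ?thesis
        by (subst nc_sum_shifted_rec, subst \<Phi>) (simp add: 1)
    qed
    show ?case using 1 2 by blast
  qed
  thus "nc_sum \<kappa> {l..<l + n} = M $ n" by blast
  have "M = 1 + fps_X * \<Phi> 1"
  proof (rule fps_ext)
    fix n show "M $ n = (1 + fps_X * \<Phi> 1) $ n"
    proof (cases n)
      case 0 thus ?thesis by (simp add: M_def)
    next
      case (Suc k)
      have "M $ n = nc_sum_shifted \<kappa> 1 1 (1 + k)"
        using nc_sum_Suc[of 0 n \<kappa>] by (simp add: M_def Suc)
      also have "\<dots> = \<Phi> 1 $ k" using main[of k] by blast
      finally show ?thesis using Suc by simp
    qed
  qed
  also have "\<dots> = (1 + fps_X * F 1) oo (fps_X * M)"
    by (simp add: \<Phi>_def fps_compose_add_distrib fps_compose_mult_distrib mult_ac)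
  also have "1 + fps_X * F 1 = Abs_fps (\<lambda>n. if n = 0 then 1 else \<kappa> n)"
    by (rule fps_ext) (simp add: F_def fps_X_mult_nth)
  finally show "M = Abs_fps (\<lambda>n. if n = 0 then 1 else \<kappa> n) oo (fps_X * M)" .
qed

section \<open>First-order expansions in $1/d$\<close>

text \<open>That is, f(d) = a + b/d + o(1/d), in the form of the second limit in the theorem; the
  first limit follows from it.\<close>

definition first_order_expansion :: "(nat \<Rightarrow> real) \<Rightarrow> real \<Rightarrow> real \<Rightarrow> bool" where
  "first_order_expansion f a b \<longleftrightarrow> (\<lambda>d. real d * (f d - a)) \<longlonglongrightarrow> b"

lemma first_order_expansion_cong:
  assumes "eventually (\<lambda>d. f d = g d) sequentially"
  shows "first_order_expansion f a b \<longleftrightarrow> first_order_expansion g a b"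
  unfolding first_order_expansion_def
  by (rule tendsto_cong) (use assms in eventually_elim, simp)

lemma first_order_expansion_imp_tendsto:
  assumes "first_order_expansion f a b"
  shows "f \<longlonglongrightarrow> a"
proof -
  have "(\<lambda>d. a + real d * (f d - a) * (1 / real d)) \<longlonglongrightarrow> a + b * 0"
    using assms unfolding first_order_expansion_def by (intro tendsto_intros lim_1_over_n)
  moreover have "eventually (\<lambda>d. a + real d * (f d - a) * (1 / real d) = f d) sequentially"
    using eventually_gt_at_top[of 0] by eventually_elim simp
  ultimately show ?thesis using tendsto_cong by fastforce
qed

lemma first_order_expansion_const [simp, intro]: "first_order_expansion (\<lambda>_. a) a 0"
  by (simp add: first_order_expansion_def)

lemma first_order_expansion_add:
  assumes "first_order_expansion f a b" "first_order_expansion g a' b'"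
  shows "first_order_expansion (\<lambda>d. f d + g d) (a + a') (b + b')"
  using tendsto_add[OF assms[unfolded first_order_expansion_def]]
  by (simp add: first_order_expansion_def algebra_simps)

lemma first_order_expansion_mult:
  assumes "first_order_expansion f a b" "first_order_expansion g a' b'"
  shows "first_order_expansion (\<lambda>d. f d * g d) (a * a') (a * b' + b * a')"
proof -
  have "(\<lambda>d. a * (real d * (g d - a')) + real d * (f d - a) * g d) \<longlonglongrightarrow> a * b' + b * a'"
    using assms[unfolded first_order_expansion_def] first_order_expansion_imp_tendsto[OF assms(2)]
    by (intro tendsto_intros)
  thus ?thesis by (simp add: first_order_expansion_def algebra_simps)
qed

lemma first_order_expansion_cmult:
  "first_order_expansion f a b \<Longrightarrow> first_order_expansion (\<lambda>d. c * f d) (c * a) (c * b)"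
  using first_order_expansion_mult[OF first_order_expansion_const, of f a b c] by simp

lemma first_order_expansion_sum:
  assumes "\<And>i. i \<in> I \<Longrightarrow> first_order_expansion (f i) (a i) (b i)"
  shows "first_order_expansion (\<lambda>d. \<Sum>i\<in>I. f i d) (\<Sum>i\<in>I. a i) (\<Sum>i\<in>I. b i)"
  using assms by (induction I rule: infinite_finite_induct) (auto intro: first_order_expansion_add)

lemma first_order_expansion_divide:
  assumes "first_order_expansion f a b"
  shows "first_order_expansion (\<lambda>d. 1 / real d * f d) 0 a"
proof -
  have "eventually (\<lambda>d. real d * (1 / real d * f d - 0) = f d) sequentially"
    using eventually_gt_at_top[of 0] by eventually_elim simp
  thus ?thesis
    using first_order_expansion_imp_tendsto[OF assms] unfolding first_order_expansion_def
    by (simp only: tendsto_cong)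
qed

text \<open>The bound \<open>k\<close> lets coefficients be treated one order at a time: products
  and \<open>fps_deriv_at_inf\<close> never look beyond it.\<close>

definition fps_expansion_upto :: "nat \<Rightarrow> (nat \<Rightarrow> real fps) \<Rightarrow> real fps \<Rightarrow> real fps \<Rightarrow> bool" where
  "fps_expansion_upto k F A B \<longleftrightarrow>
     (\<forall>j\<le>k. first_order_expansion (\<lambda>d. fps_nth (F d) j) (fps_nth A j) (fps_nth B j))"

definition fps_deriv_at_inf :: "'a::comm_ring_1 fps \<Rightarrow> 'a fps" where
  "fps_deriv_at_inf F = - (fps_X ^ 2) * fps_deriv F"

text \<open>At j = 0 the truncated difference j - 1 is 0, and the factor in front removes the
  term.\<close>

lemma fps_nth_deriv_at_inf:
  "fps_nth (fps_deriv_at_inf F) j = - (of_nat (j - 1) * fps_nth F (j - 1))"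
proof -
  have "fps_deriv_at_inf F = - (fps_X * (fps_X * fps_deriv F))"
    by (simp add: fps_deriv_at_inf_def power2_eq_square mult.assoc)
  thus ?thesis by (cases "j - 1") (simp_all add: fps_X_mult_nth del: of_nat_Suc)
qed

lemma fps_deriv_at_inf_power:
  "fps_deriv_at_inf (F ^ n) = of_nat n * F ^ (n - 1) * fps_deriv_at_inf F"
  by (simp add: fps_deriv_at_inf_def fps_deriv_power' algebra_simps)

lemma fps_expansion_upto_const: "fps_expansion_upto k (\<lambda>_. A) A 0"
  by (simp add: fps_expansion_upto_def)

lemma fps_expansion_upto_add:
  "fps_expansion_upto k F A B \<Longrightarrow> fps_expansion_upto k G A' B' \<Longrightarrow>
   fps_expansion_upto k (\<lambda>d. F d + G d) (A + A') (B + B')"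
  by (simp add: fps_expansion_upto_def first_order_expansion_add)

lemma fps_expansion_upto_mult:
  assumes "fps_expansion_upto k F A B" "fps_expansion_upto k G A' B'"
  shows "fps_expansion_upto k (\<lambda>d. F d * G d) (A * A') (A * B' + B * A')"
  unfolding fps_expansion_upto_def fps_mult_nth fps_add_nth sum.distrib[symmetric]
  using assms unfolding fps_expansion_upto_def
  by (intro allI impI first_order_expansion_sum first_order_expansion_mult) auto

text \<open>The factor 1/d makes the derivative a first-order term, so only the leading series
  \<open>A\<close> survives in it.\<close>

lemma fps_expansion_upto_deriv_at_inf:
  assumes "fps_expansion_upto k F A B"
  shows "fps_expansion_upto k (\<lambda>d. fps_const (1 / real d) * fps_deriv_at_inf (F d)) 0 (fps_deriv_at_inf A)"
  unfolding fps_expansion_upto_def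
proof (intro allI impI)
  fix j assume j: "j \<le> k"
  have "first_order_expansion (\<lambda>d. - real (j - 1) * fps_nth (F d) (j - 1))
          (- real (j - 1) * fps_nth A (j - 1)) (- real (j - 1) * fps_nth B (j - 1))"
    using assms j unfolding fps_expansion_upto_def by (intro first_order_expansion_cmult) auto
  from first_order_expansion_divide[OF this]
  show "first_order_expansion (\<lambda>d. fps_nth (fps_const (1 / real d) * fps_deriv_at_inf (F d)) j)
      (fps_nth 0 j) (fps_nth (fps_deriv_at_inf A) j)"
    by (simp add: fps_nth_deriv_at_inf)
qed

text \<open>The q_n of the overview, with e = 1/d: if p' = d p g, then the n-th derivative of p is
  d^n p q_n.\<close>

primrec higher_log_deriv :: "'a::comm_ring_1 \<Rightarrow> 'a fps \<Rightarrow> nat \<Rightarrow> 'a fps" where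
  "higher_log_deriv e g 0 = 1"
| "higher_log_deriv e g (Suc n) =
     higher_log_deriv e g n * g + fps_const e * fps_deriv_at_inf (higher_log_deriv e g n)"

text \<open>Each step multiplies by \<open>g\<close> or applies \<open>fps_deriv_at_inf\<close>, and
  either raises the order by at least one. This later confines a sum over derivatives to a range
  independent of d.\<close>

lemma higher_log_deriv_nth_less:
  assumes "fps_nth g 0 = 0" "j < n"
  shows "fps_nth (higher_log_deriv e g n) j = 0"
  using assms(2)
proof (induction n arbitrary: j)
  case (Suc n)
  have "fps_nth (higher_log_deriv e g n * g) j = 0"
    unfolding fps_mult_nth
  proof (intro sum.neutral ballI)
    fix i assume "i \<in> {0..j}"
    thus "fps_nth (higher_log_deriv e g n) i * fps_nth g (j - i) = 0"
      using Suc assms(1) by (cases "i < n") auto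
  qed
  moreover have "fps_nth (fps_deriv_at_inf (higher_log_deriv e g n)) j = 0"
    using Suc by (cases j) (auto simp: fps_nth_deriv_at_inf)
  ultimately show ?case by simp
qed simp

lemma fps_expansion_upto_higher_log_deriv:
  assumes "fps_expansion_upto k g A B"
  shows "fps_expansion_upto k (\<lambda>d. higher_log_deriv (1 / real d) (g d) n) (A ^ n)
    (of_nat n * A ^ (n - 1) * B + of_nat (n choose 2) * A ^ (n - 2) * fps_deriv_at_inf A)"
proof (induction n)
  case 0
  thus ?case using fps_expansion_upto_const[of k 1] by (simp add: numeral_2_eq_2)
next
  case (Suc n)
  have "of_nat (Suc n) * A ^ (Suc n - 1) * B + of_nat (Suc n choose 2) * A ^ (Suc n - 2) * fps_deriv_at_inf A =
    A ^ n * B + (of_nat n * A ^ (n - 1) * B + of_nat (n choose 2) * A ^ (n - 2) * fps_deriv_at_inf A) * A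
    + fps_deriv_at_inf (A ^ n)"
  proof (cases "n \<ge> 2")
    case True
    then obtain m where "n = Suc (Suc m)" by (metis One_nat_def Suc_1 Suc_le_D Suc_le_mono)
    thus ?thesis
      unfolding fps_deriv_at_inf_power by (simp add: numeral_2_eq_2 algebra_simps)
  next
    case False
    \<comment> \<open>The exponents n - 1 and n - 2 may be truncated here, but then the factors n
      and n choose 2 vanish.\<close>
    hence "n = 0 \<or> n = 1" by auto
    thus ?thesis by (auto simp: fps_deriv_at_inf_power numeral_2_eq_2 algebra_simps)
  qed
  moreover have "fps_expansion_upto k (\<lambda>d. higher_log_deriv (1 / real d) (g d) (Suc n)) (A ^ n * A + 0)
    (A ^ n * B + (of_nat n * A ^ (n - 1) * B + of_nat (n choose 2) * A ^ (n - 2) * fps_deriv_at_inf A) * A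
    + fps_deriv_at_inf (A ^ n))"
    unfolding higher_log_deriv.simps
    by (intro fps_expansion_upto_add fps_expansion_upto_mult fps_expansion_upto_deriv_at_inf[OF Suc] Suc assms)
  ultimately show ?case by (simp add: mult.commute)
qed

text \<open>As A^n has order at least n, one finite range of \<open>n\<close> serves all
  coefficients up to \<open>k\<close>, and the factor \<open>C\<close> can move inside the
  sum.\<close>

lemma fps_nth_compose_mult:
  fixes P A C :: "'a::comm_ring_1 fps"
  assumes "fps_nth A 0 = 0"
  shows "fps_nth ((P oo A) * C) k = (\<Sum>n\<le>k. fps_nth P n * fps_nth (A ^ n * C) k)"
proof -
  have "fps_nth ((P oo A) * C) k = (\<Sum>i=0..k. \<Sum>n\<le>k. fps_nth P n * fps_nth (A ^ n) i * fps_nth C (k - i))"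
    unfolding fps_mult_nth
  proof (rule sum.cong)
    fix i assume "i \<in> {0..k}"
    moreover have "fps_nth (A ^ n) i = 0" if "i < n" for n
      using startsby_zero_power_prefix[OF assms] that by blast
    ultimately have "fps_nth (P oo A) i = (\<Sum>n\<le>k. fps_nth P n * fps_nth (A ^ n) i)"
      unfolding fps_compose_nth by (intro sum.mono_neutral_left) auto
    thus "fps_nth (P oo A) i * fps_nth C (k - i) =
        (\<Sum>n\<le>k. fps_nth P n * fps_nth (A ^ n) i * fps_nth C (k - i))"
      by (simp add: sum_distrib_right)
  qed simp
  also have "\<dots> = (\<Sum>n\<le>k. fps_nth P n * fps_nth (A ^ n * C) k)"
    by (subst sum.swap) (simp add: fps_mult_nth sum_distrib_left mult.assoc)
  finally show ?thesis .
qed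

text \<open>The factor \<open>fps_X ^ r\<close> pays for an index shift by \<open>r\<close>. With r
  = 1 for F' and r = 2 for F'', both sums in the equation for B run over the index n of
  \<kappa>_n.\<close>

lemma fps_nth_compose_mult_shift:
  fixes P A C :: "'a::comm_ring_1 fps"
  assumes A: "fps_nth A 0 = 0"
  shows "fps_nth ((P oo A) * (fps_X ^ r * C)) k =
    (\<Sum>n\<le>k. if n < r then 0 else fps_nth P (n - r) * fps_nth (A ^ (n - r) * (fps_X ^ r * C)) k)"
proof (cases "k < r")
  case True
  have eq: "(P oo A) * (fps_X ^ r * C) = fps_X ^ r * ((P oo A) * C)" by (simp only: mult_ac)
  have "fps_nth ((P oo A) * (fps_X ^ r * C)) k = 0"
    using True unfolding eq by (simp add: fps_X_power_mult_nth)
  thus ?thesis using True by simp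
next
  case False
  have eq: "Q * (fps_X ^ r * C) = fps_X ^ r * (Q * C)" for Q :: "'a fps" by (simp only: mult_ac)
  have "fps_nth ((P oo A) * (fps_X ^ r * C)) k = (\<Sum>n\<le>k - r. fps_nth P n * fps_nth (A ^ n * C) (k - r))"
    using False by (simp add: eq fps_X_power_mult_nth fps_nth_compose_mult[OF A])
  also have "\<dots> = (\<Sum>n\<in>{r..k}. fps_nth P (n - r) * fps_nth (A ^ (n - r) * (fps_X ^ r * C)) k)"
    using False
    by (intro sum.reindex_bij_witness[where i = "\<lambda>n. n - r" and j = "\<lambda>n. n + r"])
       (auto simp: eq fps_X_power_mult_nth)
  also have "\<dots> = (\<Sum>n\<le>k. if n < r then 0 else fps_nth P (n - r) * fps_nth (A ^ (n - r) * (fps_X ^ r * C)) k)"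
    by (rule sum.mono_neutral_cong_left) auto
  finally show ?thesis .
qed

theorem fps_expansion_of_fixed_point:
  fixes \<kappa> :: "nat \<Rightarrow> real" and g :: "nat \<Rightarrow> real fps" and A B :: "real fps"
  defines "F \<equiv> Abs_fps \<kappa>"
  assumes g0: "\<And>d. d \<ge> 1 \<Longrightarrow> fps_nth (g d) 0 = 0"
    and g: "\<And>d k. d \<ge> 1 \<Longrightarrow>
      fps_nth (g d) (Suc k) = (\<Sum>n\<le>k. \<kappa> n * fps_nth (higher_log_deriv (1 / real d) (g d) n) k)"
    and A: "A = fps_X * (F oo A)"
    and B: "B = fps_X * ((fps_deriv F oo A) * B +
              fps_const (1/2) * ((fps_deriv (fps_deriv F) oo A) * fps_deriv_at_inf A))"
  shows "fps_expansion_upto k g A B"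
    \<comment> \<open>The coefficients of order \<open>k + 1\<close> on the left of the hypotheses on \<open>g\<close>, \<open>A\<close> and \<open>B\<close>
      involve only those up to order \<open>k\<close> on the right.\<close>
proof (induction k)
  case 0
  have "eventually (\<lambda>d. fps_nth (g d) 0 = 0) sequentially"
    using eventually_ge_at_top[of 1] by eventually_elim (rule g0)
  moreover have "fps_nth A 0 = 0" by (subst A) simp
  moreover have "fps_nth B 0 = 0" by (subst B) simp
  ultimately show ?case
    by (simp add: fps_expansion_upto_def first_order_expansion_cong)
next
  case (Suc k)
  have A0: "fps_nth A 0 = 0" by (subst A) simp
  define B' where "B' = (fps_deriv F oo A) * B +
              fps_const (1/2) * ((fps_deriv (fps_deriv F) oo A) * fps_deriv_at_inf A)"
  \<comment> \<open>\<open>B\<close> supplies its own factor \<open>fps_X\<close>, as the shift r =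
    1 for F' requires.\<close>
  have B': "B = fps_X ^ 1 * B'" unfolding B'_def power_one_right by (rule B)
  define C where "C n = of_nat n * A ^ (n - 1) * B + of_nat (n choose 2) * A ^ (n - 2) * fps_deriv_at_inf A" for n
  have "first_order_expansion (\<lambda>d. \<Sum>n\<le>k. \<kappa> n * fps_nth (higher_log_deriv (1 / real d) (g d) n) k)
      (\<Sum>n\<le>k. \<kappa> n * fps_nth (A ^ n) k) (\<Sum>n\<le>k. \<kappa> n * fps_nth (C n) k)"
    using fps_expansion_upto_higher_log_deriv[OF Suc] unfolding fps_expansion_upto_def C_def
    by (intro first_order_expansion_sum first_order_expansion_cmult) blast
  moreover have "eventually (\<lambda>d. fps_nth (g d) (Suc k) =
      (\<Sum>n\<le>k. \<kappa> n * fps_nth (higher_log_deriv (1 / real d) (g d) n) k)) sequentially"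
    using eventually_ge_at_top[of 1] by eventually_elim (rule g)
  moreover have "(\<Sum>n\<le>k. \<kappa> n * fps_nth (A ^ n) k) = fps_nth A (Suc k)"
    by (subst (2) A) (simp add: fps_compose_nth F_def atMost_atLeast0)
  moreover have "(\<Sum>n\<le>k. \<kappa> n * fps_nth (C n) k) = fps_nth B (Suc k)"
  proof -
    have 1: "fps_nth ((fps_deriv F oo A) * B) k =
      (\<Sum>n\<le>k. \<kappa> n * fps_nth (of_nat n * A ^ (n - 1) * B) k)"
      unfolding B' fps_nth_compose_mult_shift[OF A0]
      by (intro sum.cong) (auto simp: F_def fps_of_nat[symmetric] mult.assoc)
    have 2: "fps_nth (fps_const (1/2) * ((fps_deriv (fps_deriv F) oo A) * fps_deriv_at_inf A)) k =
      (\<Sum>n\<le>k. \<kappa> n * fps_nth (of_nat (n choose 2) * A ^ (n - 2) * fps_deriv_at_inf A) k)"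
    proof -
      have eq: "fps_deriv_at_inf A = fps_X ^ 2 * (- fps_deriv A)"
        by (simp add: fps_deriv_at_inf_def)
      \<comment> \<open>F'' has the coefficients n (n - 1) \<kappa>_n, half of which is (n choose 2)
        \<kappa>_n; this is the origin of the constant 1/2 in the equation for
        \<open>B\<close>.\<close>
      have "1/2 * (if n < 2 then 0 else fps_nth (fps_deriv (fps_deriv F)) (n - 2) * x) =
            \<kappa> n * (real (n choose 2) * x)" for n x
      proof (cases "n < 2")
        case True
        thus ?thesis by (simp add: binomial_eq_0)
      next
        case False
        then obtain m where m: "n = Suc (Suc m)" by (metis One_nat_def Suc_1 Suc_le_D Suc_le_mono not_less)
        have "real (Suc (Suc m) choose 2) = (1 + real m) * (2 + real m) / 2"
          by (simp add: choose_two real_of_nat_div field_simps)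
        thus ?thesis using m by (simp add: F_def)
      qed
      thus ?thesis
        unfolding eq by (simp add: fps_nth_compose_mult_shift[OF A0] sum_distrib_left
            sum_negf fps_of_nat[symmetric] mult.assoc)
    qed
    have "fps_nth B (Suc k) = fps_nth B' k" by (subst B') simp
    thus ?thesis
      unfolding B'_def fps_add_nth 1 2 by (simp add: C_def sum.distrib distrib_left)
  qed
  ultimately have "first_order_expansion (\<lambda>d. fps_nth (g d) (Suc k)) (fps_nth A (Suc k)) (fps_nth B (Suc k))"
    by (simp add: first_order_expansion_cong)
  thus ?case using Suc by (auto simp: fps_expansion_upto_def le_Suc_eq)
qed

section \<open>The differential equation for the polynomial with given cumulants\<close>

lemma poly_map_poly_add:
  fixes f :: "'a::comm_ring_1 \<Rightarrow> 'b::comm_ring_1"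
  assumes "f 0 = 0" "\<And>a b. f (a + b) = f a + f b"
  shows "poly (map_poly f (p + q)) x = poly (map_poly f p) x + poly (map_poly f q) x"
  using assms by (induction p q rule: poly_induct2) (simp_all add: map_poly_pCons algebra_simps)

text \<open>A general additive and multiplicative \<open>f\<close> serves two purposes:
  \<open>complex_of_real\<close> in the factorization and \<open>fls_const\<close> in the expansion
  at infinity.\<close>

lemma poly_map_poly_mult:
  fixes f :: "'a::comm_ring_1 \<Rightarrow> 'b::comm_ring_1"
  assumes f: "f 0 = 0" "\<And>a b. f (a + b) = f a + f b" "\<And>a b. f (a * b) = f a * f b"
  shows "poly (map_poly f (p * q)) x = poly (map_poly f p) x * poly (map_poly f q) x"
proof (induction p)
  case (pCons a p)
  have "poly (map_poly f (smult a q)) x = f a * poly (map_poly f q) x"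
    using f by (induction q) (simp_all add: map_poly_pCons algebra_simps)
  thus ?case
    using pCons f by (simp add: poly_map_poly_add map_poly_pCons algebra_simps)
qed simp

lemma poly_map_poly_of_real:
  "poly (map_poly of_real p) (of_real x :: 'a::{comm_ring_1,real_algebra_1}) = of_real (poly p x)"
  by (induction p) (simp_all add: map_poly_pCons)

text \<open>A complex root exists, is real by assumption and splits off a linear factor; the
  quotient is again real-rooted. Real-rootedness enters here, since \<open>proots\<close>, and with
  it \<open>poly_moment\<close>, sees real roots only.\<close>

lemma real_rooted_factorization:
  assumes "real_rooted p" "lead_coeff p = 1"
  shows "p = (\<Prod>x\<in>#proots p. [:- x, 1:]) \<and> size (proots p) = degree p"
  using assms
proof (induction "degree p" arbitrary: p)
  case 0
  then obtain a where "p = [:a:]" by (metis degree_eq_zeroE)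
  thus ?case using 0 by auto
next
  case (Suc n)
  let ?c = "\<lambda>p. map_poly complex_of_real p"
  have hom: "poly (?c (p * q)) z = poly (?c p) z * poly (?c q) z" for p q z
    by (rule poly_map_poly_mult) auto
  have "degree (?c p) = Suc n" using Suc by (simp add: degree_map_poly)
  hence "\<not> constant (poly (?c p))" by (simp add: constant_degree)
  then obtain z where z: "poly (?c p) z = 0" using fundamental_theorem_of_algebra by blast
  then obtain r where r: "z = of_real r"
    using Suc.prems by (auto simp: real_rooted_def elim: Reals_cases)
  have "poly p r = 0" using z unfolding r by (simp add: poly_map_poly_of_real)
  then obtain q where q: "p = [:- r, 1:] * q" by (metis poly_eq_0_iff_dvd dvdE)
  have "p \<noteq> 0" using Suc by auto
  hence "q \<noteq> 0" using q by auto
  have "lead_coeff q = 1" using Suc.prems(2) unfolding q lead_coeff_mult by simp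
  moreover have "n = degree q" using Suc.hyps(2) \<open>q \<noteq> 0\<close> unfolding q by (subst (asm) degree_mult_eq) auto
  moreover have "real_rooted q"
    using Suc.prems(1) unfolding real_rooted_def q hom by simp
  ultimately have IH: "q = (\<Prod>x\<in>#proots q. [:- x, 1:]) \<and> size (proots q) = degree q"
    using Suc.hyps(1) by blast
  have "proots p = add_mset r (proots q)"
    unfolding q using \<open>q \<noteq> 0\<close> by (subst proots_mult) auto
  thus ?case using IH q Suc.hyps(2) \<open>n = degree q\<close> by simp
qed

section \<open>Polynomials as Laurent series in w = 1/x\<close>

lemma fls_X_inv_times_X: "fls_X_inv * fls_X = (1 :: 'a::field fls)"
proof -
  have "inverse fls_X * fls_X = (1 :: 'a fls)" by (rule left_inverse) simp
  thus ?thesis by (simp only: fls_inverse_X)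
qed

lemma fps_to_fls_sum: "fps_to_fls (\<Sum>i\<in>I. f i) = (\<Sum>i\<in>I. fps_to_fls (f i))"
  by (induction I rule: infinite_finite_induct) auto

text \<open>Laurent series form a field, so that p'/p makes sense there as a series in w.\<close>

definition expand_at_inf :: "real poly \<Rightarrow> real fls" where
  "expand_at_inf p = poly (map_poly fls_const p) fls_X_inv"

lemma expand_at_inf_0 [simp]: "expand_at_inf 0 = 0"
  by (simp add: expand_at_inf_def)

lemma expand_at_inf_1 [simp]: "expand_at_inf 1 = 1"
  by (simp add: expand_at_inf_def one_pCons map_poly_pCons)

lemma expand_at_inf_pCons [simp]:
  "expand_at_inf (pCons a p) = fls_const a + fls_X_inv * expand_at_inf p"
  by (simp add: expand_at_inf_def map_poly_pCons)

lemma expand_at_inf_add [simp]: "expand_at_inf (p + q) = expand_at_inf p + expand_at_inf q"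
  unfolding expand_at_inf_def by (rule poly_map_poly_add) (auto simp: fls_plus_const)

lemma expand_at_inf_sum: "expand_at_inf (\<Sum>i\<in>I. f i) = (\<Sum>i\<in>I. expand_at_inf (f i))"
  by (induction I rule: infinite_finite_induct) auto

lemma expand_at_inf_mult [simp]: "expand_at_inf (p * q) = expand_at_inf p * expand_at_inf q"
  unfolding expand_at_inf_def by (rule poly_map_poly_mult) (auto simp: fls_plus_const fls_const_mult_const)

lemma expand_at_inf_smult [simp]: "expand_at_inf (smult c p) = fls_const c * expand_at_inf p"
  using expand_at_inf_mult[of "[:c:]" p] by simp

lemma deriv_at_inf_mult: "deriv_at_inf (F * G) = F * deriv_at_inf G + deriv_at_inf F * G"
  by (simp add: deriv_at_inf_def algebra_simps)

lemma deriv_at_inf_const_mult: "deriv_at_inf (fls_const c * G) = fls_const c * deriv_at_inf G"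
  by (simp add: deriv_at_inf_def)

lemma deriv_at_inf_fps_to_fls: "deriv_at_inf (fps_to_fls F) = fps_to_fls (fps_deriv_at_inf F)"
  by (simp add: deriv_at_inf_def fps_deriv_at_inf_def fls_deriv_fps_to_fls fls_times_fps_to_fls
      fps_to_fls_power)

lemma expand_at_inf_pderiv: "expand_at_inf (pderiv p) = deriv_at_inf (expand_at_inf p)"
proof (induction p)
  case (pCons a p)
  have "fls_X ^ 2 * fls_X_inv ^ 2 = (1 :: real fls)"
    by (metis fls_X_inv_times_X mult.commute power_mult_distrib power_one)
  hence "deriv_at_inf (fls_X_inv :: real fls) = 1"
    by (simp add: deriv_at_inf_def)
  hence "deriv_at_inf (fls_const a + fls_X_inv * expand_at_inf p) =
      expand_at_inf p + fls_X_inv * deriv_at_inf (expand_at_inf p)"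
    using deriv_at_inf_mult[of fls_X_inv "expand_at_inf p"]
    by (simp add: deriv_at_inf_def distrib_left)
  thus ?case by (simp add: pderiv_pCons pCons.IH)
qed (simp add: deriv_at_inf_def)

text \<open>The sum of 1/(z - x) over x in \<open>R\<close>, expanded in w = 1/z; hence the shift of
  the exponent by one.\<close>

definition power_sum_fps :: "real multiset \<Rightarrow> real fps" where
  "power_sum_fps R = Abs_fps (\<lambda>k. if k = 0 then 0 else \<Sum>x\<in>#R. x ^ (k - 1))"

lemma expand_at_inf_linear_ne_0: "expand_at_inf [:- x, 1:] \<noteq> 0"
proof
  assume "expand_at_inf [:- x, 1:] = 0"
  hence "fls_nth (fls_const (- x) + fls_X_inv :: real fls) (- 1) = 0" by simp
  thus False by simp
qed

text \<open>The geometric series 1/(z - x) = w/(1 - x w).\<close>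

lemma linear_times_power_sum: "expand_at_inf [:- x, 1:] * fps_to_fls (power_sum_fps {#x#}) = 1"
proof -
  have "power_sum_fps {#x#} = fps_X * Abs_fps (\<lambda>n. x ^ n)"
    by (rule fps_ext) (simp add: power_sum_fps_def)
  moreover have "(1 - fps_const x * fps_X) * Abs_fps (\<lambda>n. x ^ n) = 1"
    by (rule fps_ext) (simp add: left_diff_distrib mult.assoc power_eq_if)
  moreover have "fls_const (- x) = - fls_const x" by (rule fls_eqI) simp
  hence "expand_at_inf [:- x, 1:] * fps_to_fls fps_X = fps_to_fls (1 - fps_const x * fps_X)"
    by (simp add: left_diff_distrib fls_times_fps_to_fls fls_X_inv_times_X)
  ultimately show ?thesis
    by (metis fls_times_fps_to_fls fps_to_fls_eq_1_iff mult.assoc)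
qed

lemma expand_at_inf_prod_ne_0: "expand_at_inf (\<Prod>x\<in>#R. [:- x, 1:]) \<noteq> 0"
proof (induction R)
  case (add x R)
  thus ?case
    using expand_at_inf_linear_ne_0[of x] by (simp del: expand_at_inf_pCons mult_pCons_left)
qed simp

lemma expand_at_inf_log_deriv:
  "expand_at_inf (pderiv (\<Prod>x\<in>#R. [:- x, 1:])) =
     expand_at_inf (\<Prod>x\<in>#R. [:- x, 1:]) * fps_to_fls (power_sum_fps R)"
proof (induction R)
  case empty
  have "power_sum_fps {#} = 0" by (rule fps_ext) (simp add: power_sum_fps_def)
  thus ?case by (simp add: pderiv_1)
next
  case (add x R)
  have "power_sum_fps (add_mset x R) = power_sum_fps {#x#} + power_sum_fps R"
    by (rule fps_ext) (simp add: power_sum_fps_def)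
  moreover have "pderiv [:- x, 1:] = 1" by (simp add: pderiv_pCons)
  moreover have "expand_at_inf (\<Prod>x\<in>#R. [:- x, 1:]) = expand_at_inf (\<Prod>x\<in>#R. [:- x, 1:]) *
      (expand_at_inf [:- x, 1:] * fps_to_fls (power_sum_fps {#x#}))"
    by (simp add: linear_times_power_sum del: expand_at_inf_pCons)
  ultimately show ?case
    by (simp add: pderiv_mult add algebra_simps del: expand_at_inf_pCons mult_pCons_left)
qed

text \<open>Differentiating P q_n with P' = c P g gives c P (q_n g + q_n'/c), the recursion that
  defines \<open>higher_log_deriv\<close>.\<close>

lemma expand_at_inf_higher_pderiv:
  assumes "expand_at_inf (pderiv p) = fls_const c * (expand_at_inf p * fps_to_fls g)" "c \<noteq> 0"
  shows "expand_at_inf ((pderiv ^^ n) p) =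
    fls_const (c ^ n) * (expand_at_inf p * fps_to_fls (higher_log_deriv (1 / c) g n))"
proof (induction n)
  case (Suc n)
  let ?q = "fps_to_fls (higher_log_deriv (1 / c) g n)"
  have c: "fls_const c * fls_const (1 / c) = 1" using assms(2) by (simp add: fls_const_mult_const)
  have "expand_at_inf ((pderiv ^^ Suc n) p) =
      fls_const (c ^ n) * deriv_at_inf (expand_at_inf p * ?q)"
    by (simp add: expand_at_inf_pderiv Suc deriv_at_inf_const_mult)
  also have "deriv_at_inf (expand_at_inf p * ?q) =
      expand_at_inf p * deriv_at_inf ?q + fls_const c * (expand_at_inf p * fps_to_fls g) * ?q"
    by (simp add: deriv_at_inf_mult assms(1) flip: expand_at_inf_pderiv)
  also have "expand_at_inf p * deriv_at_inf ?q =
      fls_const c * (expand_at_inf p * (fls_const (1 / c) * deriv_at_inf ?q))"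
    using c by (metis (no_types, lifting) mult.assoc mult.commute mult_1)
  also have "fls_const (c ^ n) *
      (fls_const c * (expand_at_inf p * (fls_const (1 / c) * deriv_at_inf ?q)) +
       fls_const c * (expand_at_inf p * fps_to_fls g) * ?q) =
      (fls_const (c ^ n) * fls_const c) *
        (expand_at_inf p * (?q * fps_to_fls g + fls_const (1 / c) * deriv_at_inf ?q))"
    by (simp only: algebra_simps)
  finally show ?case
    by (simp add: deriv_at_inf_fps_to_fls fls_times_fps_to_fls fls_const_mult_const mult.commute)
qed simp

section \<open>Cumulants as coefficients of a logarithmic derivative\<close>

lemma prod_minus_one_power_card:
  assumes "finite A" "partition_on A \<pi>"
  shows "(\<Prod>V\<in>\<pi>. (- 1) ^ card V) = ((- 1) ^ card A :: 'a::comm_ring_1)"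
proof -
  have "finite V" if "V \<in> \<pi>" for V
    using partition_on_block_subset[OF assms(2) that] assms(1) by (rule finite_subset)
  hence "card A = sum card \<pi>" by (intro product_partition assms(2))
  thus ?thesis by (simp add: power_sum)
qed

definition normalized_coeff :: "real poly \<Rightarrow> nat \<Rightarrow> real" where
  "normalized_coeff p i = (-1) ^ i * signed_coeff p i / falling_factorial (degree p) i"

lemma coeff_eq_normalized_coeff:
  assumes "i \<le> degree p"
  shows "coeff p (degree p - i) = falling_factorial (degree p) i * normalized_coeff p i"
  using falling_factorial_nonzero[OF assms]
  by (simp add: normalized_coeff_def signed_coeff_def flip: mult.assoc power_mult_distrib)

text \<open>For monic \<open>p\<close> of degree \<open>d\<close>, let $h(s)$ be the generating function of
  \<open>normalized_coeff p\<close>. Then $p(x) = h(d/dx)\, x^d$, since $(d/dx)^i x^d = (d)_i\, x^{d-i}$.\<close>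

lemma finite_free_cumulant_eq_log_deriv:
  fixes p :: "real poly"
  assumes "Suc m \<le> degree p" "lead_coeff p = 1"
  defines "h \<equiv> Abs_fps (normalized_coeff p)"
  shows "fps_nth (fps_deriv h / h) m = - finite_free_cumulant p (Suc m) / real (degree p) ^ m"
proof -
  define d where "d = degree p"
  define c where "c k = fact k * normalized_coeff p k" for k
  define A where "A = {1..Suc m}"
  have A: "finite A" "card A = Suc m" by (simp_all add: A_def)
  have "h = 1 + Abs_fps (\<lambda>k. if k = 0 then 0 else c k / fact k)"
    using assms(2) by (intro fps_ext) (simp add: h_def c_def normalized_coeff_def signed_coeff_def falling_factorial_def)
  moreover from this have "fps_deriv h = fps_deriv (Abs_fps (\<lambda>k. if k = 0 then 0 else c k / fact k))"
    by simp
  ultimately have log: "fact m * fps_nth (fps_deriv h / h) m =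
      (\<Sum>\<pi> | partition_on A \<pi>. (-1) ^ (card \<pi> - 1) * fact (card \<pi> - 1) * (\<Prod>V\<in>\<pi>. c (card V)))"
    using sum_partition_on_log[OF A, of c] by simp
  \<comment> \<open>Two signs: (-1)^(card \<pi>) is minus the sign in the logarithm, and the signs
    in \<open>normalized_coeff\<close> multiply over the blocks to (-1)^(m+1), which cancels that of
    (-d)^(m+1).\<close>
  have "(-1) ^ card \<pi> * ((\<Prod>V\<in>\<pi>. fact (card V)) * (\<Prod>V\<in>\<pi>. signed_coeff p (card V)) * fact (card \<pi> - 1)) /
         (\<Prod>V\<in>\<pi>. falling_factorial d (card V)) =
        - ((-1) ^ Suc m * ((-1) ^ (card \<pi> - 1) * fact (card \<pi> - 1) * (\<Prod>V\<in>\<pi>. c (card V))))"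
    if p: "partition_on A \<pi>" for \<pi>
  proof -
    have "finite \<pi>" by (rule finite_elements[OF A(1) p])
    moreover have "\<pi> \<noteq> {}" using partition_onD1[OF p] A by auto
    ultimately have "card \<pi> > 0" by (simp add: card_gt_0_iff)
    hence sgn: "(-1) ^ card \<pi> = - ((-1) ^ (card \<pi> - 1) :: real)" by (cases "card \<pi>") auto
    have "(\<Prod>V\<in>\<pi>. c (card V)) = (\<Prod>V\<in>\<pi>. fact (card V)) * ((\<Prod>V\<in>\<pi>. (-1) ^ card V) *
        (\<Prod>V\<in>\<pi>. signed_coeff p (card V)) / (\<Prod>V\<in>\<pi>. falling_factorial d (card V)))"
      by (simp add: c_def normalized_coeff_def d_def prod.distrib prod_dividef)
    also have "(\<Prod>V\<in>\<pi>. (-1) ^ card V) = ((-1) ^ Suc m :: real)"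
      using prod_minus_one_power_card[OF A(1) p] A(2) by simp
    finally show ?thesis unfolding sgn by (simp flip: power_add power_mult_distrib)
  qed
  hence "(\<Sum>\<pi>\<in>set_partitions (Suc m). (-1) ^ card \<pi> *
           ((\<Prod>V\<in>\<pi>. fact (card V)) * (\<Prod>V\<in>\<pi>. signed_coeff p (card V)) * fact (card \<pi> - 1)) /
         (\<Prod>V\<in>\<pi>. falling_factorial d (card V))) =
        - ((-1) ^ Suc m * (fact m * fps_nth (fps_deriv h / h) m))"
    unfolding log sum_distrib_left sum_negf[symmetric] set_partitions_def A_def[symmetric]
    by (intro sum.cong) auto
  moreover have "d > 0" using assms(1) by (simp add: d_def)
  moreover have "(- real d) ^ Suc m = (-1) ^ Suc m * real d ^ Suc m" by (rule power_minus)
  ultimately have "finite_free_cumulant p (Suc m) =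
      - (((-1) ^ Suc m * (-1) ^ Suc m) * (real d ^ m * fps_nth (fps_deriv h / h) m))"
    by (simp add: finite_free_cumulant_def Let_def d_def[symmetric])
  also have "(-1) ^ Suc m * (-1) ^ Suc m = (1::real)" by (simp flip: power_mult_distrib)
  finally show ?thesis using \<open>d > 0\<close> by (simp add: d_def[symmetric])
qed

lemma falling_factorial_fact: "i \<le> d \<Longrightarrow> falling_factorial (real d) i = fact d / fact (d - i)"
proof (induction i)
  case (Suc i)
  hence "Suc (d - Suc i) = d - i" by simp
  hence "fact (d - i) = real (d - i) * fact (d - Suc i)" by (metis fact_Suc of_nat_mult of_nat_fact)
  moreover have "falling_factorial (real d) (Suc i) = falling_factorial (real d) i * real (d - i)"
    using Suc by (simp add: falling_factorial_def of_nat_diff)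
  ultimately show ?case using Suc by simp
qed (simp add: falling_factorial_def)

text \<open>Coefficient i - 1 of h' = (h'/h) h. The logarithmic derivative is known up to order d -
  1, which i \<le> d respects.\<close>

lemma normalized_coeff_rec:
  assumes "1 \<le> i" "i \<le> degree p" "lead_coeff p = 1"
  shows "real i * normalized_coeff p i =
    - (\<Sum>n=1..i. finite_free_cumulant p n / real (degree p) ^ (n - 1) * normalized_coeff p (i - n))"
proof -
  define h where "h = Abs_fps (normalized_coeff p)"
  obtain m where m: "i = Suc m" using assms(1) by (cases i) auto
  have "fps_nth h 0 = 1"
    using assms(3) by (simp add: h_def normalized_coeff_def signed_coeff_def falling_factorial_def)
  hence "(fps_deriv h / h) * h = fps_deriv h"
    by (simp add: fps_divide_unit mult.assoc inverse_mult_eq_1)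
  hence "real i * normalized_coeff p i = fps_nth ((fps_deriv h / h) * h) m"
    by (simp add: h_def m)
  also have "\<dots> = (\<Sum>j=0..m. - finite_free_cumulant p (Suc j) / real (degree p) ^ j * normalized_coeff p (m - j))"
    unfolding fps_mult_nth
  proof (intro sum.cong refl)
    fix j assume "j \<in> {0..m}"
    hence "fps_nth (fps_deriv h / h) j = - finite_free_cumulant p (Suc j) / real (degree p) ^ j"
      unfolding h_def using assms m by (intro finite_free_cumulant_eq_log_deriv) auto
    thus "fps_nth (fps_deriv h / h) j * fps_nth h (m - j) =
      - finite_free_cumulant p (Suc j) / real (degree p) ^ j * normalized_coeff p (m - j)"
      by (simp add: h_def)
  qed
  also have "\<dots> = (\<Sum>n=1..i. - finite_free_cumulant p n / real (degree p) ^ (n - 1) * normalized_coeff p (i - n))"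
    by (rule sum.reindex_bij_witness[where i = "\<lambda>n. n - 1" and j = Suc]) (auto simp: m)
  finally show ?thesis by (simp add: sum_negf)
qed

text \<open>With $E = \exp(-d \sum_n \kappa_n (D/d)^n / n)$, so that $p = E x^d$, this is the commutator
  relation $E x = (x - \sum_n \kappa_n (D/d)^{n-1}) E$ applied to $D x^d$.\<close>

lemma finite_free_cumulant_ode:
  fixes p :: "real poly"
  assumes d: "degree p = d" "d \<ge> 1" and monic: "lead_coeff p = 1"
    and \<kappa>: "\<kappa> 0 = 1" "\<And>n. n \<in> {1..d} \<Longrightarrow> finite_free_cumulant p n = \<kappa> n"
  shows "smult (1 / real d) (pCons 0 (pderiv p)) = (\<Sum>n\<le>d. smult (\<kappa> n / real d ^ n) ((pderiv ^^ n) p))"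
proof (rule poly_eqI)
  fix k
  show "coeff (smult (1 / real d) (pCons 0 (pderiv p))) k =
      coeff (\<Sum>n\<le>d. smult (\<kappa> n / real d ^ n) ((pderiv ^^ n) p)) k"
  proof (cases "k \<le> d")
    case False
    hence "coeff (pCons 0 (pderiv p)) k = 0"
      using d by (cases k) (simp_all add: coeff_pderiv coeff_eq_0)
    moreover have "coeff ((pderiv ^^ n) p) k = 0" for n
      using False d by (simp add: coeff_higher_pderiv coeff_eq_0)
    ultimately show ?thesis by (simp only: coeff_smult coeff_sum) simp
  next
    case True
    define i where "i = d - k"
    have i: "k = d - i" "i \<le> d" using True by (simp_all add: i_def)
    let ?f = "normalized_coeff p" and ?F = "falling_factorial (real d)"
    have "coeff (pCons 0 (pderiv p)) k = real k * coeff p k"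
      by (cases k) (simp_all add: coeff_pderiv)
    hence lhs: "coeff (pCons 0 (pderiv p)) k = (real d - real i) * (?F i * ?f i)"
      using coeff_eq_normalized_coeff[of i p] d i(2) unfolding i(1) by (simp add: of_nat_diff)
    \<comment> \<open>The falling factorials fit together: the n-th derivative takes h_j (d)_j
      x^(d-j) to h_j (d)_(j+n) x^(d-j-n), so at x^(d-i) every derivative carries the same factor
      (d)_i.\<close>
    have coeff: "coeff ((pderiv ^^ n) p) k = (if n \<le> i then ?F i * ?f (i - n) else 0)" for n
    proof (cases "n \<le> i")
      case True
      have eq: "k + n = degree p - (i - n)" using True i d by simp
      have "i - n \<le> degree p" using i(2) d by simp
      from coeff_eq_normalized_coeff[OF this]
      have "coeff p (k + n) = ?F (i - n) * ?f (i - n)" unfolding eq d(1) .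
      moreover have "pochhammer (real (Suc k)) n = fact (k + n) / fact k"
        using pochhammer_product'[of "1::real" k n] by (simp flip: pochhammer_fact)
      moreover have "?F (i - n) = fact d / fact (k + n)" "?F i = fact d / fact k"
        using True i by (simp_all add: falling_factorial_fact)
      ultimately show ?thesis using True by (simp add: coeff_higher_pderiv del: of_nat_Suc)
    next
      case False
      thus ?thesis using i d by (simp add: coeff_higher_pderiv coeff_eq_0)
    qed
    have "coeff (\<Sum>n\<le>d. smult (\<kappa> n / real d ^ n) ((pderiv ^^ n) p)) k =
        (\<Sum>n\<le>i. \<kappa> n / real d ^ n * (?F i * ?f (i - n)))"
      unfolding coeff_sum coeff_smult coeff
      using i by (intro sum.mono_neutral_cong_right) auto
    also have "\<dots> = ?F i * (\<Sum>n\<le>i. \<kappa> n / real d ^ n * ?f (i - n))"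
      by (simp add: sum_distrib_left mult_ac)
    also have "(\<Sum>n\<le>i. \<kappa> n / real d ^ n * ?f (i - n)) =
        ?f i + (\<Sum>n=1..i. \<kappa> n / real d ^ n * ?f (i - n))"
      by (simp add: atMost_atLeast0 sum.atLeast_Suc_atMost \<kappa>(1))
    \<comment> \<open>One factor 1/d is split off 1/d^n to match
      \<open>normalized_coeff_rec\<close>. Together with the term n = 0 this leaves 1 - i/d, the
      eigenvalue of x D / d on x^(d-i).\<close>
    also have "(\<Sum>n=1..i. \<kappa> n / real d ^ n * ?f (i - n)) = - (real i / real d * ?f i)"
    proof (cases "i = 0")
      case False
      have "(\<Sum>n=1..i. \<kappa> n / real d ^ n * ?f (i - n)) =
         1 / real d * (\<Sum>n=1..i. finite_free_cumulant p n / real (degree p) ^ (n - 1) * ?f (i - n))"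
        unfolding sum_distrib_left
      proof (intro sum.cong refl)
        fix n assume n: "n \<in> {1..i}"
        hence "real d ^ n = real d * real d ^ (n - 1)" by (cases n) auto
        moreover have "finite_free_cumulant p n = \<kappa> n" using n i by (intro \<kappa>) auto
        ultimately show "\<kappa> n / real d ^ n * ?f (i - n) =
          1 / real d * (finite_free_cumulant p n / real (degree p) ^ (n - 1) * ?f (i - n))"
          using d by simp
      qed
      also have "(\<Sum>n=1..i. finite_free_cumulant p n / real (degree p) ^ (n - 1) * ?f (i - n)) =
          - (real i * ?f i)"
        using normalized_coeff_rec[of i p] False i d monic by simp
      finally show ?thesis by simp
    qed simp
    finally have "coeff (\<Sum>n\<le>d. smult (\<kappa> n / real d ^ n) ((pderiv ^^ n) p)) k =
        ?F i * (?f i - real i / real d * ?f i)" by simp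
    thus ?thesis unfolding coeff_smult lhs using d by (simp add: field_simps)
  qed
qed

section \<open>The recursion for the Cauchy transform of a polynomial\<close>

definition poly_cauchy_transform :: "real poly \<Rightarrow> real fps" where
  "poly_cauchy_transform p = Abs_fps (\<lambda>k. if k = 0 then 0 else poly_moment p (k - 1))"

lemma poly_cauchy_transform_rec:
  fixes p :: "real poly"
  assumes d: "degree p = d" "d \<ge> 1" and monic: "lead_coeff p = 1" and rr: "real_rooted p"
    and \<kappa>: "\<kappa> 0 = 1" "\<And>n. n \<in> {1..d} \<Longrightarrow> finite_free_cumulant p n = \<kappa> n"
  defines "g \<equiv> poly_cauchy_transform p"
  shows "fps_nth g (Suc k) = (\<Sum>n\<le>k. \<kappa> n * fps_nth (higher_log_deriv (1 / real d) g n) k)"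
proof -
  let ?q = "higher_log_deriv (1 / real d) g" and ?P = "expand_at_inf p"
  have p: "p = (\<Prod>x\<in>#proots p. [:- x, 1:])"
    using real_rooted_factorization[OF rr monic] by blast
  have P: "?P \<noteq> 0" by (subst p) (rule expand_at_inf_prod_ne_0)
  have c: "fls_const (real d) * fls_const (1 / real d) = 1" using d by (simp add: fls_const_mult_const)
  have "power_sum_fps (proots p) = fps_const (real d) * g"
    using d by (intro fps_ext) (simp add: power_sum_fps_def g_def poly_cauchy_transform_def poly_moment_def)
  hence P': "expand_at_inf (pderiv p) = fls_const (real d) * (?P * fps_to_fls g)"
    using expand_at_inf_log_deriv[of "proots p", folded p]
    by (simp add: fls_times_fps_to_fls mult_ac)
  have deriv: "fls_const (1 / real d ^ n) * expand_at_inf ((pderiv ^^ n) p) = ?P * fps_to_fls (?q n)" for n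
    using expand_at_inf_higher_pderiv[OF P'] d by (simp add: fls_const_mult_const flip: mult.assoc)
  have "fls_X_inv * (?P * fps_to_fls g) = expand_at_inf (smult (1 / real d) (pCons 0 (pderiv p)))"
    using c by (simp add: P' mult.commute mult.left_commute)
  also have "\<dots> = (\<Sum>n\<le>d. fls_const (\<kappa> n) * (?P * fps_to_fls (?q n)))"
    using finite_free_cumulant_ode[of p d \<kappa>] d monic \<kappa>
    by (simp add: expand_at_inf_sum deriv[symmetric] fls_const_mult_const flip: mult.assoc)
  also have "\<dots> = ?P * fps_to_fls (\<Sum>n\<le>d. fps_const (\<kappa> n) * ?q n)"
    by (simp add: fps_to_fls_sum sum_distrib_left fls_times_fps_to_fls mult_ac)
  finally have "fls_X_inv * fps_to_fls g = fps_to_fls (\<Sum>n\<le>d. fps_const (\<kappa> n) * ?q n)"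
    using P by (simp add: mult.left_commute)
  hence "(fls_X_inv * fls_X) * fps_to_fls g = fls_X * fps_to_fls (\<Sum>n\<le>d. fps_const (\<kappa> n) * ?q n)"
    by (simp only: mult.assoc mult.left_commute[of fls_X_inv])
  hence "fps_to_fls g = fls_X * fps_to_fls (\<Sum>n\<le>d. fps_const (\<kappa> n) * ?q n)"
    by (simp only: fls_X_inv_times_X mult_1)
  also have "\<dots> = fps_to_fls (fps_X * (\<Sum>n\<le>d. fps_const (\<kappa> n) * ?q n))"
    by (simp add: fls_times_fps_to_fls)
  finally have "g = fps_X * (\<Sum>n\<le>d. fps_const (\<kappa> n) * ?q n)" by simp
  from arg_cong[OF this, of "\<lambda>f. fps_nth f (Suc k)"]
  have "fps_nth g (Suc k) = (\<Sum>n\<le>d. \<kappa> n * fps_nth (?q n) k)"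
    by (simp only: fps_X_mult_nth) (simp add: fps_sum_nth)
  \<comment> \<open>The range n \<le> d becomes n \<le> k in two moves: for n > d the n-th
    derivative of \<open>p\<close> is zero and so is \<open>?q n\<close>; for n > k the series
    \<open>?q n\<close> has order above \<open>k\<close>.\<close>
  also have "\<dots> = (\<Sum>n\<le>max d k. \<kappa> n * fps_nth (?q n) k)"
  proof (rule sum.mono_neutral_left)
    have "?q n = 0" if "n > d" for n
    proof -
      have "(pderiv ^^ n) p = 0"
        using that d by (intro poly_eqI) (simp add: coeff_higher_pderiv coeff_eq_0)
      thus ?thesis using deriv[of n] P by simp
    qed
    thus "\<forall>n\<in>{..max d k} - {..d}. \<kappa> n * fps_nth (?q n) k = 0" by auto
  qed auto
  also have "\<dots> = (\<Sum>n\<le>k. \<kappa> n * fps_nth (?q n) k)"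
    by (rule sum.mono_neutral_right)
       (auto simp: higher_log_deriv_nth_less g_def poly_cauchy_transform_def)
  finally show ?thesis .
qed

section \<open>The infinitesimal transforms\<close>

text \<open>The equation identifies \<open>G\<close> with \<open>fps_inv H\<close>, which is a
  two-sided inverse.\<close>

lemma fps_compose_inverse_commute:
  fixes G H :: "'a::field fps"
  assumes "H oo G = fps_X" and G0: "fps_nth G 0 = 0" and H: "fps_nth H 0 = 0" "fps_nth H 1 \<noteq> 0"
  shows "G oo H = fps_X"
proof -
  have "fps_inv H oo (H oo G) = (fps_inv H oo H) oo G"
    by (rule fps_compose_assoc[OF G0 H(1)])
  hence "G = fps_inv H"
    using assms(1) G0 fps_inv[OF H] by simp
  thus ?thesis using fps_inv[OF H] by simp
qed

text \<open>Elimination of F1 = F'(G) and F2 = F''(G) from the first two derivatives of G = w F(G)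
  and the equation of Y = 2 B. In a general ring the composites are mere letters, and keeping the
  factor P = 1 - w F1 avoids division.\<close>

lemma first_order_elimination:
  fixes w G G1 G2 F1 F2 P Y D DD :: "'a::comm_ring_1"
  assumes G: "w * P * G1 = G" and G2: "P * G2 = 2 * F1 * G1 + w * F2 * G1 ^ 2"
    and Y: "P * Y = w * F2 * D" and D: "D = - (w ^ 2 * G1)"
    and DD: "DD = 2 * w ^ 3 * G1 + w ^ 4 * G2" and P: "P = 1 - w * F1"
  shows "P * (Y * D * G) = P * (DD * G - 2 * D ^ 2)"
proof -
  have "P * (DD * G - 2 * D ^ 2) =
      2 * w ^ 2 * G * (w * P * G1) + w ^ 4 * (P * G2) * G - 2 * w ^ 3 * (w * P * G1) * G1"
    unfolding DD D by (simp add: algebra_simps numeral_eq_Suc)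
  also have "\<dots> = 2 * w ^ 2 * G * (G - w * (1 - w * F1) * G1) + w ^ 5 * F2 * G1 ^ 2 * G"
    unfolding G G2 by (simp add: algebra_simps numeral_eq_Suc)
  also have "\<dots> = (w * F2 * D) * D * G"
    unfolding P[symmetric] G D by (simp add: algebra_simps numeral_eq_Suc)
  also have "\<dots> = (P * Y) * D * G"
    by (simp only: Y)
  finally show ?thesis by (simp only: mult.assoc)
qed

section \<open>Solving the equations for G and B\<close>

context
  fixes F G B :: "real fps"
  assumes F0: "fps_nth F 0 = 1"
    and G: "G = fps_X * (F oo G)"
    and B: "B = fps_X * ((fps_deriv F oo G) * B +
              fps_const (1/2) * ((fps_deriv (fps_deriv F) oo G) * fps_deriv_at_inf G))"
begin

lemma fixed_point_nth_0: "fps_nth G 0 = 0"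
  by (subst G) simp

lemma fixed_point_nth_1: "fps_nth G 1 = 1"
  by (subst G) (simp add: F0)

text \<open>The formula B = G''/(2 G') - G'/G with denominators cleared. Its derivatives are in x,
  whereas \<open>fps_deriv\<close> in the proof is the derivative in w.\<close>

lemma fps_infinitesimal_identity:
  "2 * B * fps_deriv_at_inf G * G =
     fps_deriv_at_inf (fps_deriv_at_inf G) * G - 2 * fps_deriv_at_inf G ^ 2"
proof -
  define F1 F2 where "F1 = (fps_deriv F oo G)" and "F2 = (fps_deriv (fps_deriv F) oo G)"
  define D where "D = fps_deriv_at_inf G"
  define P where "P = 1 - fps_X * F1"
  have "fps_deriv G = (F oo G) + fps_X * (F1 * fps_deriv G)"
    using arg_cong[OF G, of fps_deriv] by (simp add: F1_def fps_compose_deriv fixed_point_nth_0 add.commute)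
  hence h1: "P * fps_deriv G = F oo G"
    by (simp add: P_def algebra_simps)
  have h1': "fps_X * P * fps_deriv G = G"
    by (simp only: mult.assoc h1 G[symmetric])
  have "P * fps_deriv (fps_deriv G) + fps_deriv P * fps_deriv G = F1 * fps_deriv G"
    using arg_cong[OF h1, of fps_deriv] by (simp add: F1_def fps_compose_deriv fixed_point_nth_0 algebra_simps)
  moreover have "fps_deriv P = - F1 - fps_X * (F2 * fps_deriv G)"
    by (simp add: P_def F1_def F2_def fps_compose_deriv fixed_point_nth_0)
  ultimately have h2: "P * fps_deriv (fps_deriv G) = 2 * F1 * fps_deriv G + fps_X * F2 * fps_deriv G ^ 2"
    by (simp add: algebra_simps power2_eq_square)
  \<comment> \<open>The constant 1/2 acts only through 2 c = 1, so the relation is written for 2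
    B.\<close>
  define c where "c = fps_const (1/2 :: real)"
  have c: "2 * c = 1" by (simp add: c_def numeral_fps_const)
  have "2 * B = 2 * (fps_X * (F1 * B + c * (F2 * D)))"
    using B unfolding F1_def F2_def D_def c_def by (rule arg_cong)
  also have "\<dots> = fps_X * (F1 * (2 * B) + (2 * c) * (F2 * D))"
    by (simp add: algebra_simps)
  finally have "2 * B = fps_X * (F1 * (2 * B) + F2 * D)" by (simp only: c mult_1)
  hence "2 * B - fps_X * (F1 * (2 * B)) = fps_X * (F1 * (2 * B) + F2 * D) - fps_X * (F1 * (2 * B))"
    by (rule arg_cong)
  hence h3: "P * (2 * B) = fps_X * F2 * D"
    by (simp only: P_def left_diff_distrib mult_1 mult.assoc distrib_left add_diff_cancel_left')
  have D: "D = - (fps_X ^ 2 * fps_deriv G)"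
    by (simp add: D_def fps_deriv_at_inf_def)
  have DD: "fps_deriv_at_inf D = 2 * fps_X ^ 3 * fps_deriv G + fps_X ^ 4 * fps_deriv (fps_deriv G)"
    unfolding D fps_deriv_at_inf_def
    by (simp add: fps_deriv_power' algebra_simps power2_eq_square power3_eq_cube power4_eq_xxxx)
  have "P * (2 * B * D * G) = P * (fps_deriv_at_inf D * G - 2 * D ^ 2)"
    by (rule first_order_elimination[OF h1' h2 h3 D DD P_def])
  moreover have "fps_nth P 0 = 1" by (simp add: P_def)
  hence "P \<noteq> 0" by auto
  ultimately show ?thesis by (simp add: D_def)
qed

lemma fls_infinitesimal_identity:
  "fps_to_fls B =
     deriv_at_inf (deriv_at_inf (fps_to_fls G)) / (2 * deriv_at_inf (fps_to_fls G))
     - deriv_at_inf (fps_to_fls G) / fps_to_fls G"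
proof -
  let ?D = "fps_deriv_at_inf G"
  \<comment> \<open>G = w + ... and G' = - w^2 + ..., so both denominators are nonzero.\<close>
  have "fps_nth ?D 2 = - 1" using fixed_point_nth_1 by (simp add: fps_nth_deriv_at_inf)
  hence nz: "fps_to_fls ?D \<noteq> 0" "fps_to_fls G \<noteq> 0" using fixed_point_nth_1 by auto
  have "2 * fps_to_fls B * fps_to_fls ?D * fps_to_fls G =
      fps_to_fls (fps_deriv_at_inf ?D) * fps_to_fls G - 2 * fps_to_fls ?D ^ 2"
    using arg_cong[OF fps_infinitesimal_identity, of fps_to_fls]
    by (simp add: fls_times_fps_to_fls fps_to_fls_power)
  thus ?thesis using nz
    by (simp add: deriv_at_inf_fps_to_fls divide_simps) (simp add: algebra_simps power2_eq_square)
qed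

text \<open>Under w = H(u) = 1/K(u) the equation for B reads (1 - H F') b = - H^3 F'' g / 2 with g =
  1/H', and H F = u turns it into 2 H'^2 F b = - H^3 F''. Writing H = 1/K and F = u K gives the
  claim.\<close>

lemma fls_infinitesimal_R_transform:
  defines "K \<equiv> fls_X_inv * fps_to_fls F"
  shows "- fls_deriv K * compose_at_inf (fps_to_fls B) K =
    fls_deriv (fls_deriv K) / (2 * fls_deriv K) + fls_X_inv"
proof -
  define H where "H = fps_X * inverse F"
  have FF: "F * inverse F = 1" using F0 by (simp add: inverse_mult_eq_1')
  have H01: "fps_nth H 0 = 0" "fps_nth H 1 = 1" using F0 by (simp_all add: H_def)
  hence "H \<noteq> 0" by auto
  have "fps_nth (F oo G) 0 \<noteq> 0" using F0 by simp
  hence "(F oo G) * inverse (F oo G) = 1" by (rule inverse_mult_eq_1')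
  moreover have "H oo G = G * inverse (F oo G)"
    using F0 by (simp add: H_def fps_compose_mult_distrib fixed_point_nth_0 fps_inverse_compose)
  \<comment> \<open>H(G) = G/F(G), which is w by the equation for \<open>G\<close>.\<close>
  ultimately have "H oo G = fps_X"
    using G by (metis mult.assoc mult.right_neutral)
  hence GH: "G oo H = fps_X"
    by (rule fps_compose_inverse_commute[OF _ fixed_point_nth_0 H01(1)]) (use H01 in simp)
  define g where "g = fps_deriv G oo H"
  define b where "b = B oo H"
  have g: "g * fps_deriv H = 1"
    using arg_cong[OF GH, of fps_deriv] by (simp add: fps_compose_deriv H01 g_def)
  have HF: "H * F = fps_X" using FF by (simp add: H_def mult_ac)
  have comp: "(P oo G) oo H = P" for P
    using fps_compose_assoc[OF H01(1) fixed_point_nth_0, of P] by (simp add: GH)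
  have "fps_deriv_at_inf G oo H = - (H ^ 2) * g"
    unfolding fps_deriv_at_inf_def
    by (simp add: fps_compose_mult_distrib[OF H01(1)] fps_compose_uminus fps_compose_power[OF H01(1), symmetric] H01 g_def)
  hence b: "b = H * (fps_deriv F * b + fps_const (1/2) * (fps_deriv (fps_deriv F) * (- (H ^ 2) * g)))"
    using arg_cong[OF B, of "\<lambda>f. f oo H"]
    by (simp only: fps_compose_mult_distrib[OF H01(1)] fps_compose_add_distrib comp fps_const_compose
        fps_X_fps_compose_startby0[OF H01(1)] b_def)
  define c where "c = fps_const (1/2 :: real)"
  have c: "2 * c = 1" by (simp add: c_def numeral_fps_const)
  from b have "(1 - H * fps_deriv F) * b = - (c * (H ^ 3 * fps_deriv (fps_deriv F) * g))"
    unfolding c_def[symmetric] by (simp add: algebra_simps power2_eq_square power3_eq_cube)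
  moreover have "1 - H * fps_deriv F = fps_deriv H * F"
    using arg_cong[OF HF, of fps_deriv] by (simp add: algebra_simps)
  ultimately have "fps_deriv H * F * b = - (c * (H ^ 3 * fps_deriv (fps_deriv F) * g))"
    by simp
  hence "2 * (fps_deriv H * (fps_deriv H * F * b)) =
      - ((2 * c) * (H ^ 3 * fps_deriv (fps_deriv F) * (g * fps_deriv H)))"
    by (simp add: algebra_simps)
  hence "2 * (fps_deriv H ^ 2 * F * b) = - (H ^ 3 * fps_deriv (fps_deriv F))"
    unfolding g c by (simp only: power2_eq_square mult.assoc mult_1 mult_1_right)
  from arg_cong[OF this, of fps_to_fls]
  have key: "2 * (fls_deriv (fps_to_fls H) ^ 2 * fps_to_fls F * fps_to_fls b) =
      - (fps_to_fls H ^ 3 * fls_deriv (fls_deriv (fps_to_fls F)))"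
    by (simp add: fls_times_fps_to_fls fps_to_fls_power fls_deriv_fps_to_fls)
  define h where "h = fps_to_fls H"
  define f where "f = fps_to_fls F"
  have "fps_nth (fps_deriv H) 0 = 1" using H01 by simp
  hence "fps_deriv H \<noteq> 0" by (metis fps_zero_nth zero_neq_one)
  hence nz: "h \<noteq> 0" "fls_deriv h \<noteq> 0" "f \<noteq> 0"
    using \<open>H \<noteq> 0\<close> F0 by (auto simp: h_def f_def fls_deriv_fps_to_fls simp del: fps_deriv_eq_0_iff)
  have hf: "h * f = fls_X"
    using HF by (simp add: h_def f_def flip: fls_times_fps_to_fls)
  have XK: "fls_X * K = f"
    using fls_X_inv_times_X[where 'a = real] by (simp add: K_def f_def mult.assoc[symmetric] mult.commute)
  have hK: "h * K = 1"
    using hf fls_X_inv_times_X[where 'a = real] by (simp add: K_def f_def[symmetric] mult.left_commute)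
  have "fls_deriv h * K + h * fls_deriv K = 0"
    using arg_cong[OF hK, of fls_deriv] by (simp add: algebra_simps)
  hence "h * (fls_deriv h * K + h * fls_deriv K) = 0" by simp
  hence "fls_deriv h * (h * K) + h ^ 2 * fls_deriv K = 0"
    by (simp only: power2_eq_square distrib_left mult.assoc mult.left_commute)
  hence K': "h ^ 2 * fls_deriv K = - fls_deriv h"
    using hK by (simp add: add_eq_0_iff)
  hence K'_nz: "fls_deriv K \<noteq> 0" using nz by auto
  have "K + fls_X * fls_deriv K = fls_deriv f"
    using arg_cong[OF XK, of fls_deriv] by (simp add: algebra_simps)
  from arg_cong[OF this, of fls_deriv]
  have K'': "2 * fls_deriv K + fls_X * fls_deriv (fls_deriv K) = fls_deriv (fls_deriv f)"
    by (simp add: algebra_simps)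
  have "inverse K = h" using hK by (metis inverse_unique mult.commute)
  hence "compose_at_inf (fps_to_fls B) K = fps_to_fls b"
    using \<open>H \<noteq> 0\<close> H01 by (simp add: compose_at_inf_def h_def b_def)
  moreover have "- fls_deriv K * fps_to_fls b * (2 * fls_deriv K * fls_X) =
      fls_deriv (fls_deriv K) * fls_X + 2 * fls_deriv K"
  proof -
    \<comment> \<open>The power \<open>h ^ 4\<close> clears the denominators of K'^2, as K' = -
      h'/h^2.\<close>
    have "h ^ 4 * (- fls_deriv K * fps_to_fls b * (2 * fls_deriv K * fls_X)) =
        - ((h ^ 2 * fls_deriv K) ^ 2 * (2 * fps_to_fls b * fls_X))"
      by (simp add: algebra_simps power2_eq_square power4_eq_xxxx)
    also have "\<dots> = - h * (2 * (fls_deriv h ^ 2 * f * fps_to_fls b))"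
      unfolding K' hf[symmetric] by (simp add: algebra_simps power2_eq_square)
    also have "\<dots> = h ^ 4 * fls_deriv (fls_deriv f)"
      unfolding key[folded h_def f_def] by (simp add: power3_eq_cube power4_eq_xxxx)
    finally have "- fls_deriv K * fps_to_fls b * (2 * fls_deriv K * fls_X) = fls_deriv (fls_deriv f)"
      using nz(1) by (simp only: mult_cancel_left power_eq_0_iff) simp
    thus ?thesis using K'' by (simp only: mult.commute add.commute)
  qed
  moreover have "fls_deriv (fls_deriv K) / (2 * fls_deriv K) + fls_X_inv =
      (fls_deriv (fls_deriv K) * fls_X + 2 * fls_deriv K) / (2 * fls_deriv K * fls_X)"
  proof -
    have "fls_X_inv = 1 / (fls_X :: real fls)"
      by (simp only: divide_inverse fls_inverse_X mult_1)
    moreover have nz2: "2 * fls_deriv K \<noteq> 0" using K'_nz by simp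
    ultimately show ?thesis
      using add_frac_eq[OF nz2 fls_X_nonzero, of "fls_deriv (fls_deriv K)" 1] by (simp only: mult_1)
  qed
  moreover have "2 * fls_deriv K * fls_X \<noteq> 0" using K'_nz by simp
  ultimately show ?thesis
    by (metis nonzero_eq_divide_eq)
qed

end

text \<open>The equation is linear in \<open>B\<close>, and the coefficient 1 - w F(G) is a unit. It
  is applied with F' in place of \<open>F\<close>.\<close>

lemma fps_first_order_term_exists:
  fixes F G D :: "real fps"
  obtains B where "B = fps_X * ((F oo G) * B + D)"
proof
  let ?P = "1 - fps_X * (F oo G)"
  let ?B = "inverse ?P * (fps_X * D)"
  have "fps_nth ?P 0 \<noteq> 0" by simp
  hence "?P * inverse ?P = 1" by (rule inverse_mult_eq_1')
  hence "?P * ?B = fps_X * D" by (simp only: mult.assoc[symmetric] mult_1)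
  thus "?B = fps_X * ((F oo G) * ?B + D)" by (simp add: left_diff_distrib distrib_left mult.assoc diff_eq_eq add.commute)
qed

lemma moment_eq_nc_sum:
  assumes "prob_space \<mu>"
  shows "moment \<mu> n = nc_sum (free_cumulant \<mu>) {0..<n}"
proof (cases "n = 0")
  case True
  thus ?thesis using prob_space.prob_space[OF assms] by (simp add: moment_def)
next
  case False
  let ?\<kappa> = "free_cumulant \<mu>"
  have "moment \<mu> n = (\<Sum>\<pi>\<in>nc_partitions n. \<Prod>V\<in>\<pi>. ?\<kappa> (card V))"
    using is_free_cumulants_of_free_cumulant[of \<mu>] False by (simp add: is_free_cumulants_of_def)
  also have "\<dots> = nc_sum ?\<kappa> {1..n}"
    unfolding nc_sum_around_def
    by (intro sum.cong) (auto simp: nc_partitions_def set_partitions_def unseparated_def)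
  \<comment> \<open>\<open>nc_partitions\<close> lives on intervals from 1, the generating function
    on intervals from 0; the sum depends only on the length.\<close>
  also have "{1..n} = {1..<1 + n}" by auto
  also have "nc_sum ?\<kappa> {1..<1 + n} = nc_sum ?\<kappa> {0..<0 + n}"
    by (simp only: nc_sum_functional_equation(2))
  finally show ?thesis by simp
qed

theorem theorem5p5:
  fixes \<mu> :: "real measure"
  assumes "prob_space \<mu>"
    and "sets \<mu> = sets borel"
    and "\<And>n. integrable \<mu> (\<lambda>x. x ^ n)"
    and "\<And>d. d \<ge> 1 \<Longrightarrow> real_rooted (measure_poly \<mu> d)"
  shows "\<exists>m' :: nat \<Rightarrow> real.
    infinitesimal_asymptotic_distribution (measure_poly \<mu>) (moment \<mu>) m' \<and>
    inf_cauchy_transform m' =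
      deriv_at_inf (deriv_at_inf (cauchy_transform \<mu>)) / (2 * deriv_at_inf (cauchy_transform \<mu>))
      - deriv_at_inf (cauchy_transform \<mu>) / cauchy_transform \<mu> \<and>
    inf_R_transform \<mu> m' =
      fls_deriv (fls_deriv (K_transform \<mu>)) / (2 * fls_deriv (K_transform \<mu>)) + fls_X_inv"
proof -
  \<comment> \<open>\<open>free_cumulant \<mu> 0\<close> is 0 by convention; the value 1 makes F(u)
    = u K(u), its constant term being the pole 1/u of K.\<close>
  define \<kappa> where "\<kappa> n = (if n = 0 then 1 else free_cumulant \<mu> n)" for n
  define F where "F = Abs_fps \<kappa>"
  define G where "G = fps_X * Abs_fps (moment \<mu>)"
  have F0: "fps_nth F 0 = 1" by (simp add: F_def \<kappa>_def)
  have "Abs_fps (moment \<mu>) = F oo G"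
    using nc_sum_functional_equation(1)[of "free_cumulant \<mu>"]
    by (simp add: moment_eq_nc_sum[OF assms(1), abs_def] F_def G_def \<kappa>_def[abs_def])
  hence G: "G = fps_X * (F oo G)" by (metis G_def)
  obtain B where B: "B = fps_X * ((fps_deriv F oo G) * B +
      fps_const (1/2) * ((fps_deriv (fps_deriv F) oo G) * fps_deriv_at_inf G))"
    by (rule fps_first_order_term_exists)
  define g where "g d = poly_cauchy_transform (measure_poly \<mu> d)" for d
  have expansion: "fps_expansion_upto k g G B" for k
  proof (rule fps_expansion_of_fixed_point[of g \<kappa>, folded F_def])
    fix d k :: nat assume d: "d \<ge> 1"
    show "fps_nth (g d) 0 = 0" by (simp add: g_def poly_cauchy_transform_def)
    have "has_finite_free_cumulants d (free_cumulant \<mu>) (measure_poly \<mu> d)"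
      by (rule has_finite_free_cumulants_measure_poly)
    thus "fps_nth (g d) (Suc k) = (\<Sum>n\<le>k. \<kappa> n * fps_nth (higher_log_deriv (1 / real d) (g d) n) k)"
      unfolding g_def using assms(4)[OF d] d
      by (intro poly_cauchy_transform_rec) (auto simp: has_finite_free_cumulants_def \<kappa>_def)
  qed (fact G B)+
  \<comment> \<open>The shift by one is that of G_inf, where m'_n belongs to z^(-n-1).\<close>
  define m' where "m' n = fps_nth B (Suc n)" for n
  have "infinitesimal_asymptotic_distribution (measure_poly \<mu>) (moment \<mu>) m'"
    unfolding infinitesimal_asymptotic_distribution_def
  proof (intro allI impI)
    fix n
    have "first_order_expansion (\<lambda>d. fps_nth (g d) (Suc n)) (fps_nth G (Suc n)) (fps_nth B (Suc n))"
      using expansion[of "Suc n"] by (simp add: fps_expansion_upto_def)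
    hence "first_order_expansion (\<lambda>d. poly_moment (measure_poly \<mu> d) n) (moment \<mu> n) (m' n)"
      by (simp add: g_def poly_cauchy_transform_def G_def m'_def)
    thus "(\<lambda>d. poly_moment (measure_poly \<mu> d) n) \<longlonglongrightarrow> moment \<mu> n \<and>
        (\<lambda>d. real d * (poly_moment (measure_poly \<mu> d) n - moment \<mu> n)) \<longlonglongrightarrow> m' n"
      using first_order_expansion_imp_tendsto by (auto simp: first_order_expansion_def)
  qed
  moreover have cauchy: "cauchy_transform \<mu> = fps_to_fls G"
    unfolding cauchy_transform_def by (intro arg_cong[of _ _ fps_to_fls] fps_ext) (simp add: G_def)
  moreover have inf_cauchy: "inf_cauchy_transform m' = fps_to_fls B"
  proof -
    \<comment> \<open>\<open>inf_cauchy_transform\<close> starts at w^2, so the coefficients 0 and 1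
      of \<open>B\<close> have to vanish. The latter reflects that the zeroth moment is 1 for every
      d.\<close>
    have B0: "fps_nth B 0 = 0" by (subst B) simp
    have "fps_nth B (Suc 0) = 0"
      by (subst B) (simp add: B0 fps_nth_deriv_at_inf)
    thus ?thesis
      unfolding inf_cauchy_transform_def using B0
      by (intro arg_cong[of _ _ fps_to_fls] fps_ext) (auto simp: m'_def le_Suc_eq)
  qed
  moreover have K: "K_transform \<mu> = fls_X_inv * fps_to_fls F"
  proof -
    have "F = 1 + fps_X * Abs_fps (\<lambda>k. free_cumulant \<mu> (k + 1))"
      by (rule fps_ext) (simp add: F_def \<kappa>_def)
    hence "fls_X_inv * fps_to_fls F = fls_X_inv + (fls_X_inv * fls_X) * fps_to_fls (Abs_fps (\<lambda>k. free_cumulant \<mu> (k + 1)))"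
      by (simp add: distrib_left fls_times_fps_to_fls mult.assoc)
    thus ?thesis by (simp add: K_transform_def fls_X_inv_times_X)
  qed
  ultimately show ?thesis
    using fls_infinitesimal_identity[OF F0 G B] fls_infinitesimal_R_transform[OF F0 G B]
    by (intro exI[of _ m']) (simp add: inf_R_transform_def)
qed

end
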